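(* Let $F$ satisfy the structural hypotheses (i)–(iv) of the context with $\alpha\ge 0$, and let $f$ be continuous on $I$. Then every (continuous) radial viscosity solution $u$ of $F(x,\nabla u,D^2u)=f(|x|)$ in $\Omega$ is of class $\mathcal{C}^{1,\frac{1}{1+\alpha}}$.
   Context: Setting. $\Omega\subset\mathbb{R}^N$ is a ball $B(0,R)$ or an annulus $\{R_1<|x|<R_2\}$; correspondingly $I=[0,R)$ or $I=(R_1,R_2)$. $S$ is the space of $N\times N$ symmetric real matrices. $F:\Omega\times(\mathbb{R}^N\setminus\{0\})\times S\to\mathbb{R}$ is continuous and satisfies, for some real $\alpha\ge 0$ and constants $a,A>0$: (i) $F(x,tp,\mu M)=|t|^\alpha\mu F(x,p,M)$ for all $x\in\Omega$, $p\ne0$, $M\in S$, $t\in\mathbb{R}\setminus\{0\}$, $\mu>0$; (ii) $a|p|^\alpha\,\mathrm{tr}(Q)\le F(x,p,M+Q)-F(x,p,M)\le A|p|^\alpha\,\mathrm{tr}(Q)$ for all $x\in\Omega$, $p\neq0$, $M\in S$ and $Q\in S$ with $Q\ge0$; (iii) $F({}^tOx,{}^tOp,{}^tOMO)=F(x,p,M)$ for every orthogonal matrix $O$ and all $x\in\Omega$, $p\ne0$, $M\in S$; (iv) there are $\nu>0$ and $\kappa\in(1/2,1]$ such that $|F(x,p+q,M)-F(x,p,M)|\le\nu|q|^\kappa|M|$ for all $x\in\Omega$, $|p|=1$, $|q|\le\frac12$, $M\in S$. Viscosity solutions. A continuous function $v$ on $\Omega$ is a viscosity super-solution (resp. sub-solution)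 of $F(x,\nabla v,D^2v)=f(|x|)$ if for every $x_0\in\Omega$: either there is an open ball $B(x_0,\delta)\subset\Omega$, $\delta>0$, on which $v$ is constant and $0\le f(|x|)$ (resp. $0\ge f(|x|)$) for all $x\in B(x_0,\delta)$; or, for every $\varphi\in\mathcal{C}^2(\Omega)$ such that $v-\varphi$ has a local minimum (resp. local maximum) at $x_0$ and $\nabla\varphi(x_0)\ne0$, one has $F(x_0,\nabla\varphi(x_0),D^2\varphi(x_0))\le f(|x_0|)$ (resp. $\ge f(|x_0|)$). A viscosity solution is both a super- and a sub-solution. A radial function $u$ on $\Omega$ is identified with a function $u(r)$, $r=|x|\in I$, and $u'$ denotes the derivative in $r$ (one-sided at $r=0$). "Of class $\mathcal{C}^{1,\beta}$" means: $u$ is $\mathcal{C}^1$ on $I$ and every point of $I$ has a neighbourhood in $I$ on which $u'$ is Hölder continuous with exponent $\beta$. *)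

theory Defs
  imports "HOL-Analysis.Analysis"
begin

text \<open>The dimension \<open>N\<close> is \<open>CARD('n)\<close>.\<close>

definition sym_matrices :: "(real ^ 'n ^ 'n) set" where
  "sym_matrices = {M. transpose M = M}"

definition psd_matrices :: "(real ^ 'n ^ 'n) set" where
  "psd_matrices = {Q \<in> sym_matrices. \<forall>x. 0 \<le> x \<bullet> (Q *v x)}"

text \<open>\<open>\<Omega>\<close> is the domain in space, \<open>I\<close> the corresponding set of radii.
  The inner radius 0 is admitted for annuli.\<close>

definition ball_or_annulus :: "(real ^ 'n) set \<Rightarrow> real set \<Rightarrow> bool" where
  "ball_or_annulus \<Omega> I \<longleftrightarrow>
     (\<exists>R>0. \<Omega> = ball 0 R \<and> I = {0..<R}) \<or>
     (\<exists>R\<^sub>1 R\<^sub>2. 0 \<le> R\<^sub>1 \<and> R\<^sub>1 < R\<^sub>2 \<and>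
        \<Omega> = {x. R\<^sub>1 < norm x \<and> norm x < R\<^sub>2} \<and> I = {R\<^sub>1<..<R\<^sub>2})"

text \<open>\<open>\<phi>\<close> is of class \<open>C\<^sup>2\<close> on the open set \<open>\<Omega>\<close>, with gradient \<open>g\<close> and Hessian \<open>H\<close>
  there; \<open>H\<close> is the Jacobian matrix of \<open>g\<close>, and its values on \<open>\<Omega>\<close> are symmetric by
  Schwarz's theorem.\<close>

definition C2_on ::
  "(real ^ 'n) set \<Rightarrow> (real ^ 'n \<Rightarrow> real) \<Rightarrow> (real ^ 'n \<Rightarrow> real ^ 'n) \<Rightarrow>
   (real ^ 'n \<Rightarrow> real ^ 'n ^ 'n) \<Rightarrow> bool" where
  "C2_on \<Omega> \<phi> g H \<longleftrightarrow>
     (\<forall>x\<in>\<Omega>. GDERIV \<phi> x :> g x) \<and>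
     (\<forall>x\<in>\<Omega>. (g has_derivative (\<lambda>h. H x *v h)) (at x)) \<and>
     continuous_on \<Omega> H"

definition local_min_at :: "('a::metric_space) set \<Rightarrow> ('a \<Rightarrow> real) \<Rightarrow> 'a \<Rightarrow> bool" where
  "local_min_at \<Omega> w x\<^sub>0 \<longleftrightarrow> (\<exists>\<delta>>0. \<forall>x \<in> \<Omega> \<inter> ball x\<^sub>0 \<delta>. w x\<^sub>0 \<le> w x)"

definition local_max_at :: "('a::metric_space) set \<Rightarrow> ('a \<Rightarrow> real) \<Rightarrow> 'a \<Rightarrow> bool" where
  "local_max_at \<Omega> w x\<^sub>0 \<longleftrightarrow> (\<exists>\<delta>>0. \<forall>x \<in> \<Omega> \<inter> ball x\<^sub>0 \<delta>. w x \<le> w x\<^sub>0)"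

text \<open>Viscosity super-/sub-solutions of \<open>F(x, \<nabla>v, D\<^sup>2v) = f(|x|)\<close> in \<open>\<Omega>\<close>. Only test
  functions with non-vanishing gradient at \<open>x\<^sub>0\<close> are used. The second alternative holds
  vacuously wherever \<open>v\<close> is locally constant, so a solution may be locally constant
  regardless of the sign of \<open>f\<close>.\<close>

definition viscosity_supersolution ::
  "(real ^ 'n) set \<Rightarrow> (real ^ 'n \<Rightarrow> real ^ 'n \<Rightarrow> real ^ 'n ^ 'n \<Rightarrow> real) \<Rightarrow> (real \<Rightarrow> real) \<Rightarrow>
   (real ^ 'n \<Rightarrow> real) \<Rightarrow> bool" where
  "viscosity_supersolution \<Omega> F f v \<longleftrightarrow>
     continuous_on \<Omega> v \<and>
     (\<forall>x\<^sub>0\<in>\<Omega>.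
        (\<exists>\<delta>>0. ball x\<^sub>0 \<delta> \<subseteq> \<Omega> \<and> v constant_on ball x\<^sub>0 \<delta> \<and>
           (\<forall>x \<in> ball x\<^sub>0 \<delta>. 0 \<le> f (norm x))) \<or>
        (\<forall>\<phi> g H. C2_on \<Omega> \<phi> g H \<longrightarrow> local_min_at \<Omega> (\<lambda>x. v x - \<phi> x) x\<^sub>0 \<longrightarrow>
           g x\<^sub>0 \<noteq> 0 \<longrightarrow> F x\<^sub>0 (g x\<^sub>0) (H x\<^sub>0) \<le> f (norm x\<^sub>0)))"

definition viscosity_subsolution ::
  "(real ^ 'n) set \<Rightarrow> (real ^ 'n \<Rightarrow> real ^ 'n \<Rightarrow> real ^ 'n ^ 'n \<Rightarrow> real) \<Rightarrow> (real \<Rightarrow> real) \<Rightarrow>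
   (real ^ 'n \<Rightarrow> real) \<Rightarrow> bool" where
  "viscosity_subsolution \<Omega> F f v \<longleftrightarrow>
     continuous_on \<Omega> v \<and>
     (\<forall>x\<^sub>0\<in>\<Omega>.
        (\<exists>\<delta>>0. ball x\<^sub>0 \<delta> \<subseteq> \<Omega> \<and> v constant_on ball x\<^sub>0 \<delta> \<and>
           (\<forall>x \<in> ball x\<^sub>0 \<delta>. 0 \<ge> f (norm x))) \<or>
        (\<forall>\<phi> g H. C2_on \<Omega> \<phi> g H \<longrightarrow> local_max_at \<Omega> (\<lambda>x. v x - \<phi> x) x\<^sub>0 \<longrightarrow>
           g x\<^sub>0 \<noteq> 0 \<longrightarrow> F x\<^sub>0 (g x\<^sub>0) (H x\<^sub>0) \<ge> f (norm x\<^sub>0)))"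

definition viscosity_solution ::
  "(real ^ 'n) set \<Rightarrow> (real ^ 'n \<Rightarrow> real ^ 'n \<Rightarrow> real ^ 'n ^ 'n \<Rightarrow> real) \<Rightarrow> (real \<Rightarrow> real) \<Rightarrow>
   (real ^ 'n \<Rightarrow> real) \<Rightarrow> bool" where
  "viscosity_solution \<Omega> F f v \<longleftrightarrow>
     viscosity_supersolution \<Omega> F f v \<and> viscosity_subsolution \<Omega> F f v"

text \<open>Class \<open>C\<^sup>1\<^sup>,\<^sup>\<beta>\<close> on an interval \<open>I\<close>, with the Hoelder condition local in \<open>I\<close>. The
  derivative is taken within \<open>I\<close>, hence one-sided at an endpoint belonging to \<open>I\<close>.\<close>

definition C1_holder_on :: "real \<Rightarrow> real set \<Rightarrow> (real \<Rightarrow> real) \<Rightarrow> bool" where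
  "C1_holder_on \<beta> I u \<longleftrightarrow>
     (\<exists>u'. (\<forall>r\<in>I. (u has_real_derivative u' r) (at r within I)) \<and>
        continuous_on I u' \<and>
        (\<forall>r\<in>I. \<exists>\<delta>>0. \<exists>C. \<forall>s \<in> I \<inter> ball r \<delta>. \<forall>t \<in> I \<inter> ball r \<delta>.
           \<bar>u' s - u' t\<bar> \<le> C * \<bar>s - t\<bar> powr \<beta>))"

end

theory Submission
  imports Defs
begin

text \<open>
  For a radial function the equation takes the form \<open>\<bar>u'\<bar>\<^sup>\<alpha> G(r, u'', u'/r) = f\<close>, and ellipticity
  turns it into \<open>\<bar>\<bar>u'\<bar>\<^sup>\<alpha> u''\<bar> \<le> C (1 + \<bar>u'\<bar>\<^bsup>1+\<alpha>\<^esup> / r)\<close>. Up to a factor the left-hand side is the derivative of the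
  flux \<open>\<bar>u'\<bar>\<^sup>\<alpha> u'\<close>. So the flux should be locally Lipschitz, and \<open>u'\<close>, being its signed power
  \<open>1 / (1 + \<alpha>)\<close>, locally Hoelder continuous with that exponent. The point is to justify this for viscosity
  solutions, which are only continuous and are tested only with non-zero gradients.

  Away from the origin, the inequality is strictly violated by a convex barrier whose flux is a
  hyperbolic sine (\<open>slope_supersolution\<close>), except at the vertex, where its slope vanishes. Hence \<open>u\<close>
  minus the barrier can have a strict interior minimum only at the vertex, and moving the vertex
  rules this out too (\<open>no_interior_min\<close>). Thus \<open>u\<close> is concave relative to the translates of the barrier,
  and so is \<open>-u\<close>. This bounds the change of slope between adjacent chords from both sides; chord slopes
  therefore converge, and \<open>u'\<close> exists with the flux being Lipschitz (\<open>derivative_offset\<close>,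
  \<open>flux_estimates\<close>).

  At the centre of a ball the term \<open>u'/r\<close> is singular. There \<open>u\<close> is compared with multiples of
  \<open>\<bar>x - z\<bar>\<^bsup>1+\<beta>\<^esup>\<close>, \<open>\<beta> = 1 / (1 + \<alpha>)\<close>, for centres \<open>z\<close> near the origin; moving the centre again gives
  \<open>\<bar>u(s) - u(0)\<bar> \<le> k s\<^bsup>1+\<beta>\<^esup>\<close> (\<open>growth_at_origin\<close>). The estimates on the intervals \<open>(c, 6 c)\<close> are then
  invariant under scaling, which makes the flux Lipschitz up to the origin with value zero there
  (\<open>origin_regularity\<close>).
\<close>

section \<open>Signed powers and the hyperbolic sine\<close>

text \<open>With exponent \<open>1 + \<alpha>\<close> this maps a slope \<open>p\<close> to the flux \<open>\<bar>p\<bar>\<^sup>\<alpha> p\<close>; exponent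
  \<open>1 / (1 + \<alpha>)\<close> recovers the slope from the flux.\<close>

definition signed_powr :: "real \<Rightarrow> real \<Rightarrow> real" where
  "signed_powr b x = sgn x * \<bar>x\<bar> powr b"

lemma signed_powr_0 [simp]: "signed_powr b 0 = 0"
  by (simp add: signed_powr_def)

lemma signed_powr_minus [simp]: "signed_powr b (- x) = - signed_powr b x"
  by (simp add: signed_powr_def sgn_minus)

lemma abs_signed_powr [simp]: "\<bar>signed_powr b x\<bar> = \<bar>x\<bar> powr b"
  by (simp add: signed_powr_def abs_mult sgn_if)

lemma signed_powr_inverse:
  assumes "a * b = 1"
  shows "signed_powr a (signed_powr b x) = x"
  using assms by (auto simp: signed_powr_def sgn_mult abs_mult sgn_if powr_powr mult.commute)

lemma signed_powr_less:
  assumes "b > 0" "x < y"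
  shows "signed_powr b x < signed_powr b y"
proof -
  consider "0 \<le> x" | "x < 0" "0 < y" | "x < 0" "y = 0" | "y < 0" using assms by linarith
  then show ?thesis
  proof cases
    case 1
    then show ?thesis using assms by (cases "x = 0") (auto simp: signed_powr_def intro: powr_less_mono2)
  next
    case 2
    then have "signed_powr b x < 0" "0 < signed_powr b y" by (auto simp: signed_powr_def)
    then show ?thesis by simp
  next
    case 3
    then show ?thesis by (auto simp: signed_powr_def)
  next
    case 4
    then show ?thesis using assms by (auto simp: signed_powr_def intro: powr_less_mono2)
  qed
qed

lemma powr_diff_le_powr:
  fixes x y b :: real
  assumes "0 < b" "b \<le> 1" "0 \<le> x" "x \<le> y"
  shows "y powr b - x powr b \<le> (y - x) powr b"
proof (cases "x = 0 \<or> x = y")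
  case False
  then have p: "0 < x" "0 < y - x" "0 < y" using assms by auto
  have *: "y powr b = y * y powr (b - 1)" if "0 < y" for y :: real
    using that by (simp add: powr_diff)
  have "y powr b = x * y powr (b-1) + (y - x) * y powr (b-1)"
    using *[OF p(3)] by (simp add: algebra_simps)
  also have "\<dots> \<le> x * x powr (b-1) + (y - x) * (y - x) powr (b-1)"
    using p assms by (intro add_mono mult_left_mono powr_mono2') auto
  finally show ?thesis using *[OF p(1)] *[OF p(2)] by simp
qed (use assms in auto)

text \<open>This is where the exponent of the regularity result originates: a slope is the signed
  power \<open>1 / (1 + \<alpha>)\<close> of its flux, so a Lipschitz flux has a Hoelder continuous slope.\<close>

lemma signed_powr_holder:
  assumes b: "0 < b" "b \<le> 1"
  shows "\<bar>signed_powr b x - signed_powr b y\<bar> \<le> 2 * \<bar>x - y\<bar> powr b"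
proof -
  have main: "\<bar>signed_powr b x - signed_powr b y\<bar> \<le> 2 * \<bar>x - y\<bar> powr b" if "x \<le> y" for x y
  proof -
    consider "0 \<le> x" | "x < 0" "0 < y" | "y \<le> 0" using that by linarith
    then show ?thesis
    proof cases
      case 1
      then have "\<bar>signed_powr b x - signed_powr b y\<bar> = y powr b - x powr b"
        using that b by (auto simp: signed_powr_def sgn_if powr_mono2)
      also have "\<dots> \<le> (y - x) powr b" using powr_diff_le_powr b 1 that by auto
      also have "\<dots> \<le> 2 * \<bar>x - y\<bar> powr b"
        using that by (simp add: abs_minus_commute)
      finally show ?thesis .
    next
      case 2
      have "\<bar>signed_powr b x - signed_powr b y\<bar> \<le> \<bar>x\<bar> powr b + \<bar>y\<bar> powr b"
        using abs_triangle_ineq4[of "signed_powr b x" "signed_powr b y"] by simp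
      also have "\<dots> \<le> \<bar>x - y\<bar> powr b + \<bar>x - y\<bar> powr b"
        using 2 b by (intro add_mono powr_mono2) auto
      finally show ?thesis by simp
    next
      case 3
      then have "\<bar>signed_powr b x - signed_powr b y\<bar> = (-x) powr b - (-y) powr b"
        using that b powr_mono2[of b "-y" "-x"] by (auto simp: signed_powr_def sgn_if)
      also have "\<dots> \<le> (-x - -y) powr b" by (rule powr_diff_le_powr) (use b 3 that in auto)
      also have "\<dots> \<le> 2 * \<bar>x - y\<bar> powr b"
        using that by (simp add: abs_minus_commute)
      finally show ?thesis .
    qed
  qed
  show ?thesis
    using main[of x y] main[of y x] by (cases "x \<le> y") (auto simp: abs_minus_commute)
qed

lemma isCont_signed_powr:
  assumes b: "0 < b" "b \<le> 1"
  shows "isCont (signed_powr b) x"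
proof -
  have "((\<lambda>y. 2 * \<bar>y - x\<bar> powr b) \<longlongrightarrow> 2 * \<bar>x - x\<bar> powr b) (at x)"
    using b by (intro tendsto_intros) auto
  then have lim: "((\<lambda>y. 2 * \<bar>y - x\<bar> powr b) \<longlongrightarrow> 0) (at x)" by simp
  have "((\<lambda>y. signed_powr b y - signed_powr b x) \<longlongrightarrow> 0) (at x)"
    by (rule Lim_null_comparison[OF _ lim]) (use signed_powr_holder[OF b] in auto)
  then show ?thesis unfolding isCont_def using LIM_zero_iff by blast
qed

lemma DERIV_signed_powr:
  assumes "x \<noteq> 0"
  shows "(signed_powr b has_real_derivative b * \<bar>x\<bar> powr (b - 1)) (at x)"
proof (cases "x > 0")
  case True
  have "((\<lambda>x. x powr b) has_real_derivative b * \<bar>x\<bar> powr (b - 1)) (at x)"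
    using True by (auto intro!: derivative_eq_intros)
  moreover have "eventually (\<lambda>y. signed_powr b y = y powr b) (nhds x)"
    using True
    by (intro eventually_mono[OF eventually_nhds_in_open[of "{0<..}" x]]) (auto simp: signed_powr_def)
  ultimately show ?thesis by (subst DERIV_cong_ev[OF refl _ refl])
next
  case False
  then have "x < 0" using assms by simp
  have "((\<lambda>x. - ((- x) powr b)) has_real_derivative b * \<bar>x\<bar> powr (b - 1)) (at x)"
    using \<open>x < 0\<close> by (auto intro!: derivative_eq_intros)
  moreover have "eventually (\<lambda>y. signed_powr b y = - ((- y) powr b)) (nhds x)"
    using \<open>x < 0\<close>
    by (intro eventually_mono[OF eventually_nhds_in_open[of "{..<0}" x]]) (auto simp: signed_powr_def)
  ultimately show ?thesis by (subst DERIV_cong_ev[OF refl _ refl])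
qed

lemma sinh_lipschitz:
  fixes x y :: real
  assumes "\<bar>x\<bar> \<le> B" "\<bar>y\<bar> \<le> B"
  shows "\<bar>sinh x - sinh y\<bar> \<le> cosh B * \<bar>x - y\<bar>"
proof -
  have "norm (sinh x - sinh y) \<le> cosh B * norm (x - y)"
  proof (rule field_differentiable_bound[where S="{-B..B}" and f'=cosh])
    fix z assume "z \<in> {-B..B}"
    then have "cosh \<bar>z\<bar> \<le> cosh B" by (subst cosh_real_nonneg_le_iff) auto
    then show "norm (cosh z) \<le> cosh B" by (simp add: cosh_real_abs)
    show "(sinh has_field_derivative cosh z) (at z within {-B..B})"
      by (auto intro!: derivative_eq_intros)
  qed (use assms in auto)
  then show ?thesis by simp
qed

section \<open>Viscosity inequalities in one variable and their barriers\<close>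

text \<open>The viscosity form of \<open>\<bar>u'\<bar>\<^sup>\<alpha> u'' \<le> C (1 + \<bar>u'\<bar>\<^bsup>1+\<alpha>\<^esup> / \<rho>)\<close>, imposed only where the touching
  function \<open>h\<close> has non-zero slope. The length \<open>\<rho>\<close> stands for the distance to the origin: with it the
  inequality scales correctly, so that constants derived from it do not depend on \<open>\<rho>\<close>.\<close>

definition touch_bound :: "real \<Rightarrow> real \<Rightarrow> real \<Rightarrow> real set \<Rightarrow> (real \<Rightarrow> real) \<Rightarrow> bool" where
  "touch_bound \<alpha> C \<rho> J u \<longleftrightarrow>
     (\<forall>r\<in>J. \<forall>h h' X. (\<forall>\<^sub>F s in nhds r. (h has_real_derivative h' s) (at s)) \<longrightarrow>
        (h' has_real_derivative X) (at r) \<longrightarrow> h' r \<noteq> 0 \<longrightarrow>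
        (\<forall>\<^sub>F s in nhds r. u r - h r \<le> u s - h s) \<longrightarrow>
        \<bar>h' r\<bar> powr \<alpha> * X \<le> C * (1 + \<bar>h' r\<bar> powr (1 + \<alpha>) / \<rho>))"

definition chord :: "(real \<Rightarrow> real) \<Rightarrow> real \<Rightarrow> real \<Rightarrow> real" where
  "chord u s t = (u t - u s) / (t - s)"

lemma chord_commute: "chord u s t = chord u t s"
  using minus_divide_divide[of "u t - u s" "t - s"] by (simp add: chord_def)

lemma chord_uminus: "chord (\<lambda>x. - u x) s t = - chord u s t"
  using minus_divide_left[of "u t - u s" "t - s"] by (simp add: chord_def)

text \<open>The barrier is the convex even function whose flux \<open>\<rho> sinh (K s / \<rho>)\<close> grows so fast that it
  violates the viscosity inequality strictly away from its vertex. The hyperbolic sine accounts for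
  the term \<open>\<bar>u'\<bar>\<^bsup>1+\<alpha>\<^esup>\<close> on the right-hand side, so no Lipschitz bound on \<open>u\<close> is needed beforehand; its
  slopes exhaust the reals, so translates of the barrier can be fitted to every chord.\<close>

locale barrier =
  fixes \<alpha> C \<rho> :: real
  assumes \<alpha>: "\<alpha> \<ge> 0" and C: "C \<ge> 0" and \<rho>: "\<rho> > 0"
begin

definition \<beta> :: real where "\<beta> = 1 / (1 + \<alpha>)"

definition K :: real where "K = (2 * C + 1) * (1 + \<alpha>)"

definition slope :: "real \<Rightarrow> real" where
  "slope s = signed_powr \<beta> (\<rho> * sinh (K * s / \<rho>))"

text \<open>The inverse of the barrier slope: the position, measured from the vertex, at which the barrier
  has slope \<open>p\<close>. Chord slopes are compared through this quantity.\<close>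

definition offset :: "real \<Rightarrow> real" where
  "offset p = \<rho> / K * arsinh (signed_powr (1 + \<alpha>) p / \<rho>)"

lemma \<beta>: "0 < \<beta>" "\<beta> \<le> 1" "(1 + \<alpha>) * \<beta> = 1" "\<beta> * (1 + \<alpha>) = 1"
  using \<alpha> by (auto simp: \<beta>_def)

lemma K_pos: "K > 0"
  using \<alpha> C by (auto simp: K_def intro!: mult_pos_pos)

lemma \<beta>_K: "\<beta> * K = 2 * C + 1"
proof -
  have "\<beta> * K = (2 * C + 1) * (\<beta> * (1 + \<alpha>))" by (simp only: K_def mult_ac)
  then show ?thesis unfolding \<beta>(4) by simp
qed

lemma slope_0 [simp]: "slope 0 = 0"
  by (simp add: slope_def)

lemma slope_less: "s < t \<Longrightarrow> slope s < slope t"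
  unfolding slope_def using \<beta> K_pos \<rho>
  by (intro signed_powr_less) (auto simp: divide_strict_right_mono)

lemma slope_offset [simp]: "slope (offset p) = p"
  using K_pos \<rho> \<beta> by (simp add: slope_def offset_def signed_powr_inverse)

lemma offset_minus [simp]: "offset (- p) = - offset p"
  by (simp add: offset_def)

lemma offset_bound:
  assumes "\<bar>p\<bar> powr (1 + \<alpha>) \<le> b * \<rho>"
  shows "K * \<bar>offset p\<bar> / \<rho> \<le> arsinh b"
proof -
  let ?y = "signed_powr (1 + \<alpha>) p / \<rho>"
  have "\<bar>?y\<bar> \<le> b" using assms \<rho> by (simp add: field_simps)
  then have "\<bar>arsinh ?y\<bar> \<le> arsinh b"
    using arsinh_less_iff_real[of b ?y] arsinh_less_iff_real[of b "- ?y"]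
    by (simp only: arsinh_minus_real) linarith
  moreover have "K * \<bar>offset p\<bar> / \<rho> = \<bar>arsinh ?y\<bar>"
    using K_pos \<rho> by (simp add: offset_def abs_mult)
  ultimately show ?thesis by simp
qed

lemma isCont_slope: "isCont slope s"
proof -
  have "isCont (\<lambda>s. \<rho> * sinh (K * s / \<rho>)) s"
    using \<rho> by (intro continuous_intros) auto
  then show ?thesis unfolding slope_def[abs_def]
    by (rule isCont_o2[OF _ isCont_signed_powr[OF \<beta>(1,2)]])
qed

lemma signed_powr_slope: "signed_powr (1 + \<alpha>) (slope s) = \<rho> * sinh (K * s / \<rho>)"
  using \<beta> by (simp add: slope_def signed_powr_inverse)

text \<open>Since \<open>\<beta> (1 + \<alpha>) = 1\<close>, the powers of the flux cancel in \<open>\<bar>slope\<bar>\<^sup>\<alpha> * slope'\<close>, which therefore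
  equals \<open>\<beta> K cosh (K s / \<rho>)\<close>; the value of \<open>K\<close> makes \<open>\<beta> K = 2 C + 1\<close>, just above the \<open>2 C\<close> that
  the bound \<open>C (1 + \<bar>sinh\<bar>) \<le> 2 C cosh\<close> requires.\<close>

lemma slope_supersolution:
  assumes "s \<noteq> 0"
  obtains X where "(slope has_real_derivative X) (at s)"
    "C * (1 + \<bar>slope s\<bar> powr (1 + \<alpha>) / \<rho>) < \<bar>slope s\<bar> powr \<alpha> * X"
proof
  let ?w = "\<rho> * sinh (K * s / \<rho>)" and ?c = "cosh (K * s / \<rho>)"
  have w: "?w \<noteq> 0" using assms \<rho> K_pos by auto
  have "((\<lambda>s. \<rho> * sinh (K * s / \<rho>)) has_real_derivative K * ?c) (at s)"
    using \<rho> by (auto intro!: derivative_eq_intros)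
  then show "(slope has_real_derivative \<beta> * \<bar>?w\<bar> powr (\<beta> - 1) * (K * ?c)) (at s)"
    unfolding slope_def[abs_def] by (rule DERIV_chain2[where g = "\<lambda>s. \<rho> * sinh (K * s / \<rho>)", OF DERIV_signed_powr[OF w]])
  have e: "\<beta> * \<alpha> + (\<beta> - 1) = 0" using \<beta> by (simp add: algebra_simps)
  have "\<bar>slope s\<bar> powr \<alpha> * (\<beta> * \<bar>?w\<bar> powr (\<beta> - 1) * (K * ?c))
      = (\<bar>?w\<bar> powr (\<beta> * \<alpha>) * \<bar>?w\<bar> powr (\<beta> - 1)) * (\<beta> * K) * ?c"
    unfolding slope_def abs_signed_powr powr_powr by simp
  also have "\<bar>?w\<bar> powr (\<beta> * \<alpha>) * \<bar>?w\<bar> powr (\<beta> - 1) = 1"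
    unfolding powr_add[symmetric] e using w by simp
  also have "1 * (\<beta> * K) * ?c = (2 * C + 1) * ?c"
    using \<beta>_K by simp
  finally have 1: "\<bar>slope s\<bar> powr \<alpha> * (\<beta> * \<bar>?w\<bar> powr (\<beta> - 1) * (K * ?c)) = (2 * C + 1) * ?c" .
  have "\<bar>slope s\<bar> powr (1 + \<alpha>) = \<bar>signed_powr (1 + \<alpha>) (slope s)\<bar>" by simp
  also have "\<dots> = \<rho> * \<bar>sinh (K * s / \<rho>)\<bar>"
    unfolding signed_powr_slope using \<rho> by (simp add: abs_mult)
  finally have 2: "\<bar>slope s\<bar> powr (1 + \<alpha>) / \<rho> = \<bar>sinh (K * s / \<rho>)\<bar>"
    using \<rho> by simp
  have "\<bar>sinh (K * s / \<rho>)\<bar> \<le> ?c"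
    using sinh_le_cosh_real[of "K * s / \<rho>"] sinh_le_cosh_real[of "- (K * s / \<rho>)"]
    by (auto simp: abs_if)
  moreover have "1 \<le> ?c" by (rule cosh_real_ge_1)
  ultimately have "C * (1 + \<bar>sinh (K * s / \<rho>)\<bar>) \<le> C * (?c + ?c)"
    using C by (intro mult_left_mono) auto
  also have "\<dots> < (2 * C + 1) * ?c" using \<open>1 \<le> ?c\<close> by (simp add: algebra_simps)
  finally show "C * (1 + \<bar>slope s\<bar> powr (1 + \<alpha>) / \<rho>)
      < \<bar>slope s\<bar> powr \<alpha> * (\<beta> * \<bar>?w\<bar> powr (\<beta> - 1) * (K * ?c))"
    unfolding 1 2 .
qed

text \<open>In general the slope has no elementary antiderivative; additive constants cancel in every comparison.\<close>

definition profile :: "real \<Rightarrow> real" where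
  "profile = (SOME \<psi>. \<forall>s. (\<psi> has_real_derivative slope s) (at s))"

lemma DERIV_profile: "(profile has_real_derivative slope s) (at s)"
proof -
  have "\<exists>\<psi>. \<forall>x. - \<infinity> < ereal x \<longrightarrow> ereal x < \<infinity> \<longrightarrow> (\<psi> has_vector_derivative slope x) (at x)"
    by (rule einterval_antiderivative) (auto intro: isCont_slope)
  then have "\<exists>\<psi>. \<forall>s. (\<psi> has_real_derivative slope s) (at s)"
    by (auto simp: has_real_derivative_iff_has_vector_derivative)
  then show ?thesis unfolding profile_def by (rule someI2_ex) blast
qed

lemma isCont_profile: "isCont profile s"
  using DERIV_profile DERIV_isCont by blast

lemma profile_mvt:
  assumes "s < t"
  obtains z where "s < z" "z < t" "profile t - profile s = (t - s) * slope z"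
  using MVT2[OF assms, of profile slope] DERIV_profile by blast

lemma profile_min:
  assumes "s \<noteq> 0"
  shows "profile 0 < profile s"
proof (cases "s < 0")
  case True
  obtain z where z: "s < z" "z < 0" "profile 0 - profile s = (0 - s) * slope z"
    using profile_mvt[OF True] by blast
  have "slope z < 0" using slope_less[OF z(2)] by simp
  then show ?thesis using z True by (smt (verit) mult_pos_neg)
next
  case False
  then have "0 < s" using assms by simp
  then obtain z where z: "0 < z" "z < s" "profile s - profile 0 = (s - 0) * slope z"
    using profile_mvt by blast
  have "slope z > 0" using slope_less[OF z(1)] by simp
  then show ?thesis using z \<open>0 < s\<close> by (smt (verit) mult_pos_pos)
qed

text \<open>At the vertex the barrier has zero slope, so the viscosity inequality says nothing there; at
  any other point the barrier violates it and cannot touch \<open>u\<close> from below.\<close>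

lemma touch_only_at_centre:
  assumes u: "touch_bound \<alpha> C \<rho> J u" and "x \<in> J"
    and min: "\<forall>\<^sub>F s in nhds x. u x - profile (x - m) \<le> u s - profile (s - m)"
  shows "x = m"
proof (rule ccontr)
  assume "x \<noteq> m"
  then obtain X where X: "(slope has_real_derivative X) (at (x - m))"
    "C * (1 + \<bar>slope (x - m)\<bar> powr (1 + \<alpha>) / \<rho>) < \<bar>slope (x - m)\<bar> powr \<alpha> * X"
    using slope_supersolution[of "x - m"] by auto
  have d: "((\<lambda>s. s - m) has_real_derivative 1) (at s)" for s
    by (auto intro!: derivative_eq_intros)
  have 1: "\<forall>\<^sub>F s in nhds x. ((\<lambda>s. profile (s - m)) has_real_derivative slope (s - m)) (at s)"
    using DERIV_chain2[where g = "\<lambda>s. s - m", OF DERIV_profile d] by simp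
  have 2: "((\<lambda>s. slope (s - m)) has_real_derivative X) (at x)"
    using DERIV_chain2[where g = "\<lambda>s. s - m", OF X(1) d] by simp
  have 3: "slope (x - m) \<noteq> 0"
    using slope_less[of "x - m" 0] slope_less[of 0 "x - m"] \<open>x \<noteq> m\<close>
    by (cases "x < m") auto
  have "\<bar>slope (x - m)\<bar> powr \<alpha> * X \<le> C * (1 + \<bar>slope (x - m)\<bar> powr (1 + \<alpha>) / \<rho>)"
    using u[unfolded touch_bound_def, rule_format, OF \<open>x \<in> J\<close> 1 2 3 min] .
  then show False using X by simp
qed

lemma interior_min_at_centre:
  assumes u: "touch_bound \<alpha> C \<rho> {c<..<d} u" and cont: "continuous_on {c<..<d} u"
    and r: "c < r" "r < s" "s < t" "t < d"
    and less: "u s - profile (s - m) < u r - profile (r - m)"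
              "u s - profile (s - m) < u t - profile (t - m)"
  shows "m \<in> {r..t}" "\<And>y. y \<in> {r..t} \<Longrightarrow> u m - profile 0 \<le> u y - profile (y - m)"
proof -
  have "continuous_on {r..t} (\<lambda>y. u y - profile (y - m))"
  proof (intro continuous_on_diff continuous_on_subset[OF cont] continuous_at_imp_continuous_on ballI)
    show "isCont (\<lambda>y. profile (y - m)) y" for y
      by (intro isCont_o2[OF _ isCont_profile] continuous_intros)
  qed (use r in auto)
  then obtain x where x: "x \<in> {r..t}"
    and min: "\<And>y. y \<in> {r..t} \<Longrightarrow> u x - profile (x - m) \<le> u y - profile (y - m)"
    using continuous_attains_inf[of "{r..t}" "\<lambda>y. u y - profile (y - m)"] r by auto
  have "u x - profile (x - m) \<le> u s - profile (s - m)" using min r by auto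
  then have "x \<noteq> r" "x \<noteq> t" using less by auto
  then have "x \<in> {r<..<t}" using x by auto
  then have "\<forall>\<^sub>F y in nhds x. y \<in> {r<..<t}" by (intro eventually_nhds_in_open) auto
  then have "\<forall>\<^sub>F y in nhds x. u x - profile (x - m) \<le> u y - profile (y - m)"
    by eventually_elim (use min in auto)
  then have "x = m" by (rule touch_only_at_centre[OF u, rotated]) (use x r in auto)
  then show "m \<in> {r..t}" "\<And>y. y \<in> {r..t} \<Longrightarrow> u m - profile 0 \<le> u y - profile (y - m)"
    using x min by auto
qed

text \<open>The vertex is excluded as a touching point by moving it: a strict interior minimum persists
  for a nearby vertex \<open>n \<noteq> m\<close>, and then \<open>u\<close> is touched at \<open>m\<close> by the barrier centred at \<open>m\<close> and at
  \<open>n\<close> by the one centred at \<open>n\<close>. Each of the values \<open>u m\<close>, \<open>u n\<close> would be strictly below the other.\<close>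

lemma no_interior_min:
  assumes u: "touch_bound \<alpha> C \<rho> {c<..<d} u" and cont: "continuous_on {c<..<d} u"
    and r: "c < r" "r < s" "s < t" "t < d"
    and less: "u s - profile (s - m) < u r - profile (r - m)"
              "u s - profile (s - m) < u t - profile (t - m)"
  shows False
proof -
  have lim: "((\<lambda>n. profile (y - n)) \<longlongrightarrow> profile (y - m)) (at m)" for y
    by (rule isCont_tendsto_compose[OF isCont_profile]) (intro tendsto_intros)
  have diff: "((\<lambda>n. u y - profile (y - n)) \<longlongrightarrow> u y - profile (y - m)) (at m)" for y
    by (intro tendsto_intros lim)
  have lim': "((\<lambda>n. (u y - profile (y - n)) - (u s - profile (s - n)))
      \<longlongrightarrow> (u y - profile (y - m)) - (u s - profile (s - m))) (at m)" for y
    by (intro tendsto_diff diff)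
  have "\<forall>\<^sub>F n in at m. 0 < (u y - profile (y - n)) - (u s - profile (s - n))"
    if "u s - profile (s - m) < u y - profile (y - m)" for y
    using order_tendstoD(1)[OF lim', of 0 y] that by simp
  then have "\<forall>\<^sub>F n in at m. n \<noteq> m \<and> 0 < (u r - profile (r - n)) - (u s - profile (s - n))
      \<and> 0 < (u t - profile (t - n)) - (u s - profile (s - n))"
    using less by (intro eventually_conj eventually_neq_at_within) auto
  then have "\<exists>n. n \<noteq> m \<and> 0 < (u r - profile (r - n)) - (u s - profile (s - n))
      \<and> 0 < (u t - profile (t - n)) - (u s - profile (s - n))"
    by (rule eventually_happens'[OF at_neq_bot])
  then obtain n where n: "n \<noteq> m" "u s - profile (s - n) < u r - profile (r - n)"
      "u s - profile (s - n) < u t - profile (t - n)"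
    by (auto simp: algebra_simps)
  note at_m = interior_min_at_centre[OF u cont r less]
  note at_n = interior_min_at_centre[OF u cont r n(2,3)]
  have "u m - profile 0 \<le> u n - profile (n - m)" using at_m(2) at_n(1) by auto
  moreover have "u n - profile 0 \<le> u m - profile (m - n)" using at_n(2) at_m(1) by auto
  ultimately show False using profile_min[of "n - m"] profile_min[of "m - n"] n(1) by auto
qed

text \<open>If the slope increased more than along the barrier between two adjacent chords, a translate of
  the barrier could be chosen steeper than \<open>u\<close> on \<open>[r, s]\<close> and flatter than \<open>u\<close> on \<open>[s, t]\<close>; the
  difference would have a strict minimum inside \<open>(r, t)\<close>.\<close>

lemma offset_chord_increase:
  assumes u: "touch_bound \<alpha> C \<rho> {c<..<d} u" and cont: "continuous_on {c<..<d} u"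
    and r: "c < r" "r < s" "s < t" "t < d"
  shows "offset (chord u s t) - offset (chord u r s) \<le> t - r"
proof (rule ccontr)
  assume "\<not> ?thesis"
  then have "t - offset (chord u s t) < r - offset (chord u r s)" by simp
  then obtain m where m: "t - offset (chord u s t) < m" "m < r - offset (chord u r s)"
    using dense by blast
  obtain y where y: "y < t - m" "profile (t - m) - profile (s - m) = (t - s) * slope y"
    using profile_mvt[of "s - m" "t - m"] r by auto
  have "slope y < slope (offset (chord u s t))" using y m by (intro slope_less) auto
  then have "(t - s) * slope y < (t - s) * chord u s t" using r by simp
  also have "\<dots> = u t - u s" using r by (simp add: chord_def)
  finally have 1: "profile (t - m) - profile (s - m) < u t - u s" using y by simp
  obtain z where z: "r - m < z" "profile (s - m) - profile (r - m) = (s - r) * slope z"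
    using profile_mvt[of "r - m" "s - m"] r by auto
  have "slope (offset (chord u r s)) < slope z" using z m by (intro slope_less) auto
  then have "(s - r) * chord u r s < (s - r) * slope z" using r by simp
  moreover have "(s - r) * chord u r s = u s - u r" using r by (simp add: chord_def)
  ultimately have 2: "u s - u r < profile (s - m) - profile (r - m)" using z by simp
  show False
    using no_interior_min[OF u cont r, of m] 1 2 by simp
qed

section \<open>Differentiability under two-sided viscosity bounds\<close>

text \<open>With the viscosity inequality for both \<open>u\<close> and \<open>-u\<close>, slopes of nearby chords are close in the
  offset scale, which yields a derivative and its modulus of continuity at the same time.\<close>

context
  fixes u :: "real \<Rightarrow> real" and c d :: real
  assumes below: "touch_bound \<alpha> C \<rho> {c<..<d} u"
    and above: "touch_bound \<alpha> C \<rho> {c<..<d} (\<lambda>x. - u x)"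
    and cont: "continuous_on {c<..<d} u"
begin

lemma offset_chord_adjacent:
  assumes r: "c < r" "r < s" "s < t" "t < d"
  shows "\<bar>offset (chord u s t) - offset (chord u r s)\<bar> \<le> t - r"
  using offset_chord_increase[OF below cont r]
    offset_chord_increase[OF above continuous_on_minus[OF cont] r]
  by (simp add: chord_uminus abs_le_iff)

text \<open>Chords from \<open>s\<close> to the same side are compared with an arbitrarily short chord to the other
  side of \<open>s\<close>.\<close>

lemma offset_chord_common:
  assumes J: "s \<in> {c<..<d}" "t \<in> {c<..<d}" "t' \<in> {c<..<d}" and ne: "t \<noteq> s" "t' \<noteq> s"
  shows "\<bar>offset (chord u s t) - offset (chord u s t')\<bar> \<le> \<bar>t - s\<bar> + \<bar>t' - s\<bar>"
proof -
  have opposite: "\<bar>offset (chord u s t) - offset (chord u s r)\<bar> \<le> t - r"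
    if "c < r" "r < s" "s < t" "t < d" for r t
    using offset_chord_adjacent[OF that] by (simp add: chord_commute[of u s r])
  consider "t < s" "s < t'" | "t' < s" "s < t" | "s < t" "s < t'" | "t < s" "t' < s"
    using ne by linarith
  then show ?thesis
  proof cases
    case 1
    then show ?thesis using opposite[of t t'] J by (simp add: abs_minus_commute)
  next
    case 2
    then show ?thesis using opposite[of t' t] J by simp
  next
    case 3
    show ?thesis
    proof (rule field_le_epsilon)
      fix e :: real assume "e > 0"
      then obtain r where r: "max c (s - e / 2) < r" "r < s"
        using dense[of "max c (s - e / 2)" s] J by auto
      have "\<bar>offset (chord u s t) - offset (chord u s r)\<bar> \<le> t - r"
        "\<bar>offset (chord u s t') - offset (chord u s r)\<bar> \<le> t' - r"
        using opposite[of r] r J 3 by auto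
      then show "\<bar>offset (chord u s t) - offset (chord u s t')\<bar> \<le> \<bar>t - s\<bar> + \<bar>t' - s\<bar> + e"
        using r 3 by (simp add: abs_if split: if_splits)
    qed
  next
    case 4
    show ?thesis
    proof (rule field_le_epsilon)
      fix e :: real assume "e > 0"
      then obtain r where r: "s < r" "r < min d (s + e / 2)"
        using dense[of s "min d (s + e / 2)"] J by auto
      have "\<bar>offset (chord u s r) - offset (chord u s t)\<bar> \<le> r - t"
        "\<bar>offset (chord u s r) - offset (chord u s t')\<bar> \<le> r - t'"
        using opposite[of _ r] r J 4 by auto
      then show "\<bar>offset (chord u s t) - offset (chord u s t')\<bar> \<le> \<bar>t - s\<bar> + \<bar>t' - s\<bar> + e"
        using r 4 by (simp add: abs_if split: if_splits)
    qed
  qed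
qed

text \<open>The intervals around \<open>offset (chord u s t)\<close> of radius \<open>\<bar>t - s\<bar>\<close> meet pairwise, so by
  completeness they have a common point.\<close>

lemma offset_chord_limit:
  assumes s: "s \<in> {c<..<d}"
  shows "\<exists>l. \<forall>t\<in>{c<..<d} - {s}. \<bar>l - offset (chord u s t)\<bar> \<le> \<bar>s - t\<bar>"
proof -
  let ?J = "{c<..<d} - {s}" and ?g = "\<lambda>t. offset (chord u s t) - \<bar>t - s\<bar>"
  have le: "?g t \<le> offset (chord u s t') + \<bar>t' - s\<bar>" if "t \<in> ?J" "t' \<in> ?J" for t t'
    using offset_chord_common[of s t t'] that s by auto
  have "(c + s) / 2 \<in> ?J" using s by auto
  then have ne: "?J \<noteq> {}" by blast
  then obtain t\<^sub>0 where t\<^sub>0: "t\<^sub>0 \<in> ?J" by blast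
  define l where "l = Sup (?g ` ?J)"
  have "bdd_above (?g ` ?J)"
    by (rule bdd_aboveI2[of ?J ?g, OF le[OF _ t\<^sub>0]])
  then have up: "?g t \<le> l" if "t \<in> ?J" for t
    unfolding l_def by (rule cSUP_upper[OF that])
  have low: "l \<le> offset (chord u s t) + \<bar>t - s\<bar>" if "t \<in> ?J" for t
    unfolding l_def by (rule cSUP_least[OF ne le[OF _ that]])
  have "\<bar>l - offset (chord u s t)\<bar> \<le> \<bar>s - t\<bar>" if "t \<in> ?J" for t
    using up[OF that] low[OF that] by linarith
  then show ?thesis by (intro exI[of _ l] ballI)
qed

text \<open>The common point \<open>T s\<close> is the limit of the chord offsets at \<open>s\<close>, so \<open>slope (T s)\<close> is the
  derivative. As \<open>T s\<close> and \<open>T t\<close> are both within \<open>\<bar>s - t\<bar>\<close> of the offset of the chord from \<open>s\<close> to \<open>t\<close>,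
  the function \<open>T\<close> has Lipschitz constant 2.\<close>

lemma derivative_offset:
  obtains T where "\<And>s. s \<in> {c<..<d} \<Longrightarrow> (u has_real_derivative slope (T s)) (at s)"
    and "\<And>s t. s \<in> {c<..<d} \<Longrightarrow> t \<in> {c<..<d} \<Longrightarrow> \<bar>T s - T t\<bar> \<le> 2 * \<bar>s - t\<bar>"
    and "\<And>s t. s \<in> {c<..<d} \<Longrightarrow> t \<in> {c<..<d} \<Longrightarrow> s \<noteq> t \<Longrightarrow>
           \<bar>T s - offset (chord u s t)\<bar> \<le> \<bar>s - t\<bar>"
proof -
  obtain T where T: "\<And>s t. s \<in> {c<..<d} \<Longrightarrow> t \<in> {c<..<d} \<Longrightarrow> s \<noteq> t \<Longrightarrow>
      \<bar>T s - offset (chord u s t)\<bar> \<le> \<bar>s - t\<bar>"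
    using bchoice[of "{c<..<d}", OF ballI[OF offset_chord_limit]] by force
  show thesis
  proof (rule that[OF _ _ T])
    fix s t assume J: "s \<in> {c<..<d}" "t \<in> {c<..<d}"
    show "\<bar>T s - T t\<bar> \<le> 2 * \<bar>s - t\<bar>"
    proof (cases "s = t")
      case False
      then have "t \<noteq> s" by simp
      from T[OF J False] T[OF J(2) J(1) this] show ?thesis
        unfolding chord_commute[of u t s] by (smt (verit))
    qed simp
  next
    fix s assume s: "s \<in> {c<..<d}"
    have "\<forall>\<^sub>F t in at s. t \<in> {c<..<d} - {s}"
      using s eventually_at_in_open[of "{c<..<d}" s] by auto
    then have "\<forall>\<^sub>F t in at s. norm (offset (chord u s t) - T s) \<le> \<bar>s - t\<bar>"
      by eventually_elim (use T[OF s] in \<open>auto simp: abs_minus_commute\<close>)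
    moreover have "((\<lambda>t. \<bar>s - t\<bar>) \<longlongrightarrow> 0) (at s)"
      by (rule tendsto_eq_intros refl | simp)+
    ultimately have "((\<lambda>t. offset (chord u s t) - T s) \<longlongrightarrow> 0) (at s)"
      by (rule Lim_null_comparison)
    then have "((\<lambda>t. offset (chord u s t)) \<longlongrightarrow> T s) (at s)"
      using LIM_zero_iff by blast
    then have "((\<lambda>t. slope (offset (chord u s t))) \<longlongrightarrow> slope (T s)) (at s)"
      by (rule isCont_tendsto_compose[OF isCont_slope])
    then show "(u has_real_derivative slope (T s)) (at s)"
      by (simp add: has_field_derivative_iff chord_def)
  qed
qed

text \<open>One chord anchors the size of \<open>T\<close>. The chord offset and the length of the interval enter \<open>B\<close> only
  relative to \<open>\<rho>\<close>, so that the estimates are invariant under scaling.\<close>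

lemma flux_estimates:
  assumes st0: "s\<^sub>0 \<in> {c<..<d}" "t\<^sub>0 \<in> {c<..<d}" "s\<^sub>0 \<noteq> t\<^sub>0"
    and B: "K * (\<bar>offset (chord u s\<^sub>0 t\<^sub>0)\<bar> + 3 * (d - c)) / \<rho> \<le> B"
    and J: "s \<in> {c<..<d}" "t \<in> {c<..<d}"
  shows "(u has_real_derivative deriv u s) (at s)"
    and "\<bar>signed_powr (1 + \<alpha>) (deriv u s)\<bar> \<le> \<rho> * sinh B"
    and "\<bar>signed_powr (1 + \<alpha>) (deriv u s) - signed_powr (1 + \<alpha>) (deriv u t)\<bar>
           \<le> 2 * K * cosh B * \<bar>s - t\<bar>"
proof -
  obtain T where D: "\<And>s. s \<in> {c<..<d} \<Longrightarrow> (u has_real_derivative slope (T s)) (at s)"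
    and T: "\<And>s t. s \<in> {c<..<d} \<Longrightarrow> t \<in> {c<..<d} \<Longrightarrow> \<bar>T s - T t\<bar> \<le> 2 * \<bar>s - t\<bar>"
    and T0: "\<And>s t. s \<in> {c<..<d} \<Longrightarrow> t \<in> {c<..<d} \<Longrightarrow> s \<noteq> t \<Longrightarrow>
           \<bar>T s - offset (chord u s t)\<bar> \<le> \<bar>s - t\<bar>"
    using derivative_offset by blast
  show "(u has_real_derivative deriv u s) (at s)"
    using D[OF J(1)] DERIV_imp_deriv by metis
  have flux: "signed_powr (1 + \<alpha>) (deriv u s) = \<rho> * sinh (K * T s / \<rho>)" if "s \<in> {c<..<d}" for s
    using DERIV_imp_deriv[OF D[OF that]] signed_powr_slope by simp
  have bound: "\<bar>K * T s / \<rho>\<bar> \<le> B" if "s \<in> {c<..<d}" for s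
  proof -
    have "\<bar>s - s\<^sub>0\<bar> \<le> d - c" "\<bar>s\<^sub>0 - t\<^sub>0\<bar> \<le> d - c" using that st0 by auto
    then have "\<bar>T s\<bar> \<le> \<bar>offset (chord u s\<^sub>0 t\<^sub>0)\<bar> + 3 * (d - c)"
      using T[OF that st0(1)] T0[OF st0] by (smt (verit))
    then have "K * \<bar>T s\<bar> / \<rho> \<le> K * (\<bar>offset (chord u s\<^sub>0 t\<^sub>0)\<bar> + 3 * (d - c)) / \<rho>"
      using K_pos \<rho> by (intro divide_right_mono mult_left_mono) auto
    then show ?thesis using B K_pos \<rho> by (simp add: abs_mult)
  qed
  have "0 \<le> B" using bound[OF J(1)] by linarith
  then have "\<bar>sinh (K * T s / \<rho>)\<bar> \<le> sinh B"
    using bound[OF J(1)] sinh_real_le_iff[of "\<bar>K * T s / \<rho>\<bar>" B]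
    by (simp only: sinh_real_abs)
  then show "\<bar>signed_powr (1 + \<alpha>) (deriv u s)\<bar> \<le> \<rho> * sinh B"
    unfolding flux[OF J(1)] using \<rho> by (simp add: abs_mult)
  have "\<bar>sinh (K * T s / \<rho>) - sinh (K * T t / \<rho>)\<bar> \<le> cosh B * \<bar>K * T s / \<rho> - K * T t / \<rho>\<bar>"
    by (rule sinh_lipschitz[OF bound[OF J(1)] bound[OF J(2)]])
  also have "K * T s / \<rho> - K * T t / \<rho> = K / \<rho> * (T s - T t)"
    by (simp add: diff_divide_distrib right_diff_distrib)
  also have "\<bar>\<dots>\<bar> = K / \<rho> * \<bar>T s - T t\<bar>" using K_pos \<rho> by (simp add: abs_mult)
  also have "cosh B * (K / \<rho> * \<bar>T s - T t\<bar>) \<le> cosh B * (K / \<rho> * (2 * \<bar>s - t\<bar>))"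
    using K_pos \<rho> T[OF J] by (intro mult_left_mono) auto
  finally have "\<rho> * \<bar>sinh (K * T s / \<rho>) - sinh (K * T t / \<rho>)\<bar> \<le> \<rho> * \<dots>"
    using \<rho> by (intro mult_left_mono) auto
  also have "\<dots> = 2 * K * cosh B * \<bar>s - t\<bar>" using \<rho> by simp
  finally show "\<bar>signed_powr (1 + \<alpha>) (deriv u s) - signed_powr (1 + \<alpha>) (deriv u t)\<bar>
      \<le> 2 * K * cosh B * \<bar>s - t\<bar>"
    unfolding flux[OF J(1)] flux[OF J(2)] using \<rho>
    by (simp add: abs_mult flip: right_diff_distrib)
qed

end

end

section \<open>Radial test functions\<close>

lemma second_derivative_test:
  fixes h h' :: "real \<Rightarrow> real"
  assumes ev: "\<forall>\<^sub>F s in nhds r. (h has_real_derivative h' s) (at s)"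
    and X: "(h' has_real_derivative X) (at r)" and 0: "h' r = 0" "X > 0"
  shows "\<forall>\<^sub>F s in nhds r. h r \<le> h s"
proof -
  obtain e where e: "e > 0" "\<And>s. dist s r < e \<Longrightarrow> (h has_real_derivative h' s) (at s)"
    using ev unfolding eventually_nhds_metric by blast
  obtain e1 where e1: "e1 > 0" "\<And>y. y > 0 \<Longrightarrow> y < e1 \<Longrightarrow> h' r < h' (r + y)"
    using DERIV_pos_inc_right[OF X 0(2)] by blast
  obtain e2 where e2: "e2 > 0" "\<And>y. y > 0 \<Longrightarrow> y < e2 \<Longrightarrow> h' (r - y) < h' r"
    using DERIV_pos_inc_left[OF X 0(2)] by blast
  have "h r \<le> h s" if s: "dist s r < min e (min e1 e2)" for s
  proof (cases s r rule: linorder_cases)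
    case less
    have "\<exists>z>s. z < r \<and> h r - h s = (r - s) * h' z"
      by (rule MVT2[OF less e(2)]) (use s less in \<open>auto simp: dist_real_def\<close>)
    then obtain z where z: "s < z" "z < r" "h r - h s = (r - s) * h' z" by blast
    have "h' z < 0" using e2(2)[of "r - z"] z s 0 by (auto simp: dist_real_def)
    then have "(r - s) * h' z \<le> 0" using less by (intro mult_nonneg_nonpos) auto
    then show ?thesis using z by simp
  next
    case greater
    have "\<exists>z>r. z < s \<and> h s - h r = (s - r) * h' z"
      by (rule MVT2[OF greater e(2)]) (use s greater in \<open>auto simp: dist_real_def\<close>)
    then obtain z where z: "r < z" "z < s" "h s - h r = (s - r) * h' z" by blast
    have "h' z > 0" using e1(2)[of "z - r"] z s 0 by (auto simp: dist_real_def)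
    then have "(s - r) * h' z \<ge> 0" using greater by (intro mult_nonneg_nonneg) auto
    then show ?thesis using z by simp
  qed simp
  moreover have "min e (min e1 e2) > 0" using e e1 e2 by simp
  ultimately show ?thesis unfolding eventually_nhds_metric by blast
qed

definition outer :: "real ^ 'n \<Rightarrow> real ^ 'n ^ 'n" where
  "outer y = (\<chi> i j. y $ i * y $ j)"

lemma outer_mult_vec: "outer y *v x = (y \<bullet> x) *\<^sub>R y"
  by (simp add: outer_def matrix_vector_mult_def vec_eq_iff inner_vec_def sum_distrib_left
      sum_distrib_right mult_ac)

lemma trace_outer: "trace (outer y) = y \<bullet> y"
  by (simp add: trace_def outer_def inner_vec_def)

lemma transpose_outer: "transpose (outer y) = outer y"
  by (simp add: transpose_def outer_def vec_eq_iff mult.commute)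

lemma trace_scaleR: "trace (c *\<^sub>R (M :: real ^ 'n ^ 'n)) = c * trace M"
  by (simp add: trace_def sum_distrib_left)

lemma transpose_add: "transpose (M + M' :: real ^ 'n ^ 'n) = transpose M + transpose M'"
  by (simp add: transpose_def vec_eq_iff)

text \<open>The Hessian at \<open>y\<close> of a radial function with radial second derivative \<open>X\<close>, where \<open>q\<close> is the
  radial derivative divided by \<open>\<bar>y\<bar>\<close>: eigenvalue \<open>X\<close> in direction \<open>y\<close> and \<open>q\<close> orthogonally to it.\<close>

definition radial_hessian :: "real ^ 'n \<Rightarrow> real \<Rightarrow> real \<Rightarrow> real ^ 'n ^ 'n" where
  "radial_hessian y q X = q *\<^sub>R mat 1 + ((X - q) / (norm y)\<^sup>2) *\<^sub>R outer y"

lemma sym_scaleR_mat_1: "q *\<^sub>R (mat 1 :: real ^ 'n ^ 'n) \<in> sym_matrices"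
  by (simp add: sym_matrices_def transpose_scalar)

lemma zero_sym: "0 \<in> (sym_matrices :: (real ^ 'n ^ 'n) set)"
  using sym_scaleR_mat_1[of 0] by simp

lemma psd_scaleR_mat_1: "q \<ge> 0 \<Longrightarrow> q *\<^sub>R (mat 1 :: real ^ 'n ^ 'n) \<in> psd_matrices"
  by (simp add: psd_matrices_def sym_scaleR_mat_1 flip: scaleR_matrix_vector_assoc)

lemma psd_scaleR_outer:
  fixes y :: "real ^ 'n"
  shows "q \<ge> 0 \<Longrightarrow> q *\<^sub>R outer y \<in> psd_matrices"
  by (simp add: psd_matrices_def sym_matrices_def transpose_scalar transpose_outer outer_mult_vec
      inner_commute mult.assoc flip: scaleR_matrix_vector_assoc)

lemma trace_radial_hessian:
  fixes y :: "real ^ 'n"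
  assumes "y \<noteq> 0"
  shows "trace (radial_hessian y q X) = (real CARD('n) - 1) * q + X"
proof -
  have "trace (radial_hessian y q X) = q * real CARD('n) + (X - q) / (norm y)\<^sup>2 * (norm y)\<^sup>2"
    by (simp add: radial_hessian_def trace_add trace_scaleR trace_I trace_outer
        flip: power2_norm_eq_inner)
  also have "(X - q) / (norm y)\<^sup>2 * (norm y)\<^sup>2 = X - q" using assms by simp
  finally show ?thesis by (simp add: algebra_simps)
qed

lemma psd_radial_hessian:
  fixes y :: "real ^ 'n"
  assumes "y \<noteq> 0" "q \<ge> 0" "X \<ge> 0"
  shows "radial_hessian y q X \<in> psd_matrices"
proof -
  have "0 \<le> x \<bullet> (radial_hessian y q X *v x)" for x
  proof -
    define t where "t = (y \<bullet> x)\<^sup>2 / (norm y)\<^sup>2"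
    have "(y \<bullet> x)\<^sup>2 \<le> (norm y)\<^sup>2 * (norm x)\<^sup>2"
      using Cauchy_Schwarz_ineq[of y x] by (simp add: power2_norm_eq_inner)
    then have t: "0 \<le> t" "t \<le> (norm x)\<^sup>2" using assms by (simp_all add: t_def field_simps)
    have "x \<bullet> (radial_hessian y q X *v x) = q * (norm x)\<^sup>2 + (X - q) * t"
      by (simp add: t_def radial_hessian_def matrix_vector_mult_add_rdistrib outer_mult_vec inner_add_right
          power2_norm_eq_inner inner_commute power2_eq_square[of "inner _ _"]
          flip: scaleR_matrix_vector_assoc)
    also have "\<dots> = q * ((norm x)\<^sup>2 - t) + X * t" by (simp add: algebra_simps)
    also have "\<dots> \<ge> 0" using assms t by (intro add_nonneg_nonneg mult_nonneg_nonneg) auto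
    finally show ?thesis .
  qed
  moreover have "radial_hessian y q X \<in> sym_matrices"
    by (simp add: radial_hessian_def sym_matrices_def transpose_add transpose_scalar transpose_outer)
  ultimately show ?thesis by (simp add: psd_matrices_def)
qed

text \<open>Polynomials in the squared distance to \<open>z\<close> are smooth on the whole space, also at \<open>z\<close>, and
  two coefficients are enough to prescribe first and second radial derivatives at a given distance.\<close>

lemma C2_on_quartic:
  fixes z :: "real ^ 'n"
  shows "C2_on \<Omega> (\<lambda>x. c1 * (norm (x - z))\<^sup>2 + c2 * (norm (x - z)) ^ 4)
     (\<lambda>x. (2 * c1 + 4 * c2 * (norm (x - z))\<^sup>2) *\<^sub>R (x - z))
     (\<lambda>x. (2 * c1 + 4 * c2 * (norm (x - z))\<^sup>2) *\<^sub>R mat 1 + (8 * c2) *\<^sub>R outer (x - z))"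
proof -
  have sq: "((\<lambda>x. (norm (x - z))\<^sup>2) has_derivative (\<lambda>h. 2 * ((x - z) \<bullet> h))) (at x)" for x
    unfolding power2_norm_eq_inner
    by (auto intro!: derivative_eq_intros simp: inner_commute)
  show ?thesis
    unfolding C2_on_def
  proof (intro conjI ballI)
    fix x :: "real ^ 'n"
    have n4: "norm y ^ 4 = ((norm y)\<^sup>2)\<^sup>2" for y :: "real ^ 'n" by simp
    show "GDERIV (\<lambda>x. c1 * (norm (x - z))\<^sup>2 + c2 * norm (x - z) ^ 4) x
        :> (2 * c1 + 4 * c2 * (norm (x - z))\<^sup>2) *\<^sub>R (x - z)"
      unfolding gderiv_def n4
      by (rule has_derivative_eq_rhs, (rule derivative_intros sq)+)
        (auto simp: algebra_simps inner_commute fun_eq_iff)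
    show "((\<lambda>x. (2 * c1 + 4 * c2 * (norm (x - z))\<^sup>2) *\<^sub>R (x - z)) has_derivative
        (*v) ((2 * c1 + 4 * c2 * (norm (x - z))\<^sup>2) *\<^sub>R mat 1 + (8 * c2) *\<^sub>R outer (x - z))) (at x)"
      by (rule has_derivative_eq_rhs, (rule derivative_intros sq)+)
        (auto simp: algebra_simps inner_commute fun_eq_iff outer_mult_vec matrix_vector_mult_add_rdistrib
          simp flip: scaleR_matrix_vector_assoc)
  next
    show "continuous_on \<Omega> (\<lambda>x. (2 * c1 + 4 * c2 * (norm (x - z))\<^sup>2) *\<^sub>R mat 1 + (8 * c2) *\<^sub>R outer (x - z))"
      unfolding outer_def by (intro continuous_intros)
  qed
qed

section \<open>Supersolutions of degenerate elliptic equations\<close>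

text \<open>The assumption \<open>tested\<close> merges the two alternatives of the viscosity definition, which is
  justified by \<open>supersolution_tested\<close> below.\<close>

locale elliptic_supersolution =
  fixes \<Omega> :: "(real ^ 'n) set"
    and F :: "real ^ 'n \<Rightarrow> real ^ 'n \<Rightarrow> real ^ 'n ^ 'n \<Rightarrow> real"
    and \<alpha> a A :: real and f :: "real \<Rightarrow> real" and v :: "real ^ 'n \<Rightarrow> real"
  assumes open_\<Omega>: "open \<Omega>" and \<alpha>: "\<alpha> \<ge> 0" and a: "a > 0" and A: "A > 0"
    and zero: "\<And>x p. x \<in> \<Omega> \<Longrightarrow> p \<noteq> 0 \<Longrightarrow> F x p 0 = 0"
    and elliptic:
      "\<And>x p M Q. x \<in> \<Omega> \<Longrightarrow> p \<noteq> 0 \<Longrightarrow> M \<in> sym_matrices \<Longrightarrow> Q \<in> psd_matrices \<Longrightarrow>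
         a * norm p powr \<alpha> * trace Q \<le> F x p (M + Q) - F x p M \<and>
         F x p (M + Q) - F x p M \<le> A * norm p powr \<alpha> * trace Q"
    and cont: "continuous_on \<Omega> v"
    and tested:
      "\<And>x\<^sub>0 \<phi> g H. x\<^sub>0 \<in> \<Omega> \<Longrightarrow> C2_on \<Omega> \<phi> g H \<Longrightarrow> local_min_at \<Omega> (\<lambda>x. v x - \<phi> x) x\<^sub>0 \<Longrightarrow>
         g x\<^sub>0 \<noteq> 0 \<Longrightarrow> F x\<^sub>0 (g x\<^sub>0) (H x\<^sub>0) \<le> f (norm x\<^sub>0)"
begin

text \<open>A function of \<open>\<bar>x - z\<bar>\<close> that is only twice differentiable at one distance may serve as test
  function: the quartic polynomial with the same radial slope and a smaller second derivative \<open>Y\<close>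
  touches it from below. The centre \<open>z\<close> is arbitrary because the behaviour of \<open>v\<close> at the origin is
  detected only by test functions centred elsewhere.\<close>

lemma radial_test:
  assumes x0: "x\<^sub>0 \<in> \<Omega>" "x\<^sub>0 \<noteq> z"
    and h: "\<forall>\<^sub>F s in nhds (norm (x\<^sub>0 - z)). (h has_real_derivative h' s) (at s)"
    and X: "(h' has_real_derivative X) (at (norm (x\<^sub>0 - z)))"
    and p: "h' (norm (x\<^sub>0 - z)) \<noteq> 0"
    and min: "\<forall>\<^sub>F x in nhds x\<^sub>0. v x\<^sub>0 - h (norm (x\<^sub>0 - z)) \<le> v x - h (norm (x - z))"
    and "Y < X"
  defines "q \<equiv> h' (norm (x\<^sub>0 - z)) / norm (x\<^sub>0 - z)"
  shows "F x\<^sub>0 (q *\<^sub>R (x\<^sub>0 - z)) (radial_hessian (x\<^sub>0 - z) q Y) \<le> f (norm x\<^sub>0)"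
proof -
  define r where "r = norm (x\<^sub>0 - z)"
  have "r > 0" using x0 by (simp add: r_def)
  define c2 where "c2 = (Y - q) / r\<^sup>2 / 8"
  define c1 where "c1 = q / 2 - 2 * c2 * r\<^sup>2"
  have c1: "2 * c1 + 4 * c2 * r\<^sup>2 = q" by (simp add: c1_def)
  have "8 * (t / 8) = t" for t :: real by simp
  from this[of "(Y - q) / r\<^sup>2"] have c2: "8 * c2 = (Y - q) / r\<^sup>2" unfolding c2_def .
  \<comment> \<open>The coefficients give the polynomial radial slope \<open>q r\<close> and second derivative \<open>Y\<close> at \<open>r\<close>, so that \<open>k\<close> has a strict local minimum there.\<close>
  define k where "k s = h s - (c1 * s\<^sup>2 + c2 * s ^ 4)" for s
  define k' where "k' s = h' s - (2 * c1 * s + 4 * c2 * s ^ 3)" for s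
  have "\<forall>\<^sub>F s in nhds r. (k has_real_derivative k' s) (at s)"
    using h unfolding r_def[symmetric]
    by eventually_elim
      (auto simp: k_def[abs_def] k'_def power2_eq_square power3_eq_cube intro!: derivative_eq_intros)
  moreover have "(k' has_real_derivative X - (2 * c1 + 12 * c2 * r\<^sup>2)) (at r)"
    using X unfolding r_def[symmetric] k'_def[abs_def]
    by (auto intro!: derivative_eq_intros)
  moreover have "k' r = 0"
  proof -
    have "k' r = q * r - (2 * c1 + 4 * c2 * r\<^sup>2) * r"
      using \<open>r > 0\<close> unfolding k'_def q_def r_def[symmetric]
      by (simp add: power2_eq_square power3_eq_cube algebra_simps)
    then show ?thesis by (simp add: c1)
  qed
  moreover have "X - (2 * c1 + 12 * c2 * r\<^sup>2) > 0"
  proof -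
    have "2 * c1 + 12 * c2 * r\<^sup>2 = (2 * c1 + 4 * c2 * r\<^sup>2) + 8 * c2 * r\<^sup>2"
      by simp
    also have "\<dots> = Y" unfolding c1 c2 using \<open>r > 0\<close> by simp
    finally show ?thesis using \<open>Y < X\<close> by simp
  qed
  ultimately have "\<forall>\<^sub>F s in nhds r. k r \<le> k s" by (rule second_derivative_test)
  moreover have "((\<lambda>x. norm (x - z)) \<longlongrightarrow> r) (nhds x\<^sub>0)"
    unfolding r_def by (intro tendsto_intros filterlim_ident)
  ultimately have "\<forall>\<^sub>F x in nhds x\<^sub>0. k r \<le> k (norm (x - z))"
    by (rule eventually_compose_filterlim)
  with min have ev: "\<forall>\<^sub>F x in nhds x\<^sub>0. v x\<^sub>0 - (c1 * (norm (x\<^sub>0 - z))\<^sup>2 + c2 * norm (x\<^sub>0 - z) ^ 4)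
      \<le> v x - (c1 * (norm (x - z))\<^sup>2 + c2 * norm (x - z) ^ 4)"
    by eventually_elim (simp add: k_def r_def)
  then have lmin: "local_min_at \<Omega> (\<lambda>x. v x - (c1 * (norm (x - z))\<^sup>2 + c2 * norm (x - z) ^ 4)) x\<^sub>0"
    unfolding local_min_at_def eventually_nhds_metric by (auto simp: dist_commute)
  have "q \<noteq> 0" using p \<open>r > 0\<close> by (simp add: q_def r_def)
  then have g: "(2 * c1 + 4 * c2 * (norm (x\<^sub>0 - z))\<^sup>2) *\<^sub>R (x\<^sub>0 - z) \<noteq> 0"
    using x0 c1 by (simp add: r_def)
  show ?thesis
    using tested[OF x0(1) C2_on_quartic lmin g] c1 c2
    by (simp add: r_def radial_hessian_def)
qed

text \<open>The Hessian is the multiple \<open>q\<close> of the identity plus a positive semidefinite matrix of rank at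
  most one; the first summand is compared with the zero matrix.\<close>

lemma radial_operator_lower_bound:
  fixes y :: "real ^ 'n"
  assumes x: "x \<in> \<Omega>" and y: "y \<noteq> 0" and q: "q \<noteq> 0" "q \<le> Y"
  defines "P \<equiv> norm (q *\<^sub>R y) powr \<alpha>"
  shows "a * P * Y \<le> F x (q *\<^sub>R y) (radial_hessian y q Y) + (A * real CARD('n) + a) * P * \<bar>q\<bar>"
proof -
  let ?I = "mat 1 :: real ^ 'n ^ 'n" and ?N = "real CARD('n)"
  have p: "q *\<^sub>R y \<noteq> 0" using y q by simp
  have P: "0 \<le> P" by (simp add: P_def)
  have I: "- (A * P * (?N * \<bar>q\<bar>)) \<le> F x (q *\<^sub>R y) (q *\<^sub>R ?I)"
  proof (cases "0 \<le> q")
    case True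
    have "a * P * trace (q *\<^sub>R ?I) \<le> F x (q *\<^sub>R y) (0 + q *\<^sub>R ?I) - F x (q *\<^sub>R y) 0"
      unfolding P_def
      using elliptic[OF x p zero_sym psd_scaleR_mat_1[OF True]] by blast
    moreover have "0 \<le> a * P * trace (q *\<^sub>R ?I)" "0 \<le> A * P * (?N * \<bar>q\<bar>)"
      using a A P True by (simp_all add: trace_scaleR trace_I)
    ultimately show ?thesis using zero[OF x p] by simp
  next
    case False
    then have "0 \<le> - q" by simp
    have "F x (q *\<^sub>R y) (q *\<^sub>R ?I + (- q) *\<^sub>R ?I) - F x (q *\<^sub>R y) (q *\<^sub>R ?I) \<le> A * P * trace ((- q) *\<^sub>R ?I)"
      unfolding P_def
      using elliptic[OF x p sym_scaleR_mat_1 psd_scaleR_mat_1[OF \<open>0 \<le> - q\<close>]] by blast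
    then show ?thesis using zero[OF x p] False by (simp add: trace_scaleR trace_I mult_ac del: scaleR_minus_left) (simp add: mult_ac)
  qed
  have "0 \<le> (Y - q) / (norm y)\<^sup>2" using q by simp
  then have "a * P * trace (((Y - q) / (norm y)\<^sup>2) *\<^sub>R outer y)
      \<le> F x (q *\<^sub>R y) (radial_hessian y q Y) - F x (q *\<^sub>R y) (q *\<^sub>R ?I)"
    unfolding P_def radial_hessian_def
    using elliptic[OF x p sym_scaleR_mat_1 psd_scaleR_outer] by blast
  moreover have "trace (((Y - q) / (norm y)\<^sup>2) *\<^sub>R outer y) = Y - q"
    using y by (simp add: trace_scaleR trace_outer flip: power2_norm_eq_inner)
  ultimately have "a * P * (Y - q) \<le> F x (q *\<^sub>R y) (radial_hessian y q Y) + A * P * (?N * \<bar>q\<bar>)"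
    using I by simp
  moreover have "a * P * q \<le> a * P * \<bar>q\<bar>" using a P by (intro mult_left_mono) auto
  ultimately show ?thesis by (simp add: algebra_simps)
qed

text \<open>The term \<open>u' / r\<close> of the tangential eigenvalues is bounded by \<open>u' / c\<close>, which is why \<open>c\<close>
  appears as the length scale.\<close>

lemma touch_bound_radial:
  assumes c: "0 < c" and annulus: "\<And>x :: real ^ 'n. c < norm x \<Longrightarrow> norm x < d \<Longrightarrow> x \<in> \<Omega>"
    and radial: "\<And>x. x \<in> \<Omega> \<Longrightarrow> v x = u (norm x)"
    and M: "\<And>r. c < r \<Longrightarrow> r < d \<Longrightarrow> \<bar>f r\<bar> \<le> M"
  shows "touch_bound \<alpha> ((M + (A * real CARD('n) + a)) / a) c {c<..<d} u"
  unfolding touch_bound_def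
proof (intro ballI allI impI)
  fix r h h' X
  assume r: "r \<in> {c<..<d}" and h: "\<forall>\<^sub>F s in nhds r. (h has_real_derivative h' s) (at s)"
    and X: "(h' has_real_derivative X) (at r)" and p: "h' r \<noteq> 0"
    and min: "\<forall>\<^sub>F s in nhds r. u r - h r \<le> u s - h s"
  define x0 :: "real ^ 'n" where "x0 = r *\<^sub>R axis undefined 1"
  define q where "q = h' r / r"
  define P where "P = \<bar>h' r\<bar> powr \<alpha>"
  let ?B = "A * real CARD('n) + a"
  have r0: "r > 0" using c r by auto
  have nx: "norm x0 = r" using r0 by (simp add: x0_def norm_axis_1)
  then have x0: "x0 \<in> \<Omega>" "x0 \<noteq> 0" using annulus[of x0] r r0 by auto
  have q: "q \<noteq> 0" using p r0 by (simp add: q_def)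
  have nq: "norm (q *\<^sub>R x0) = \<bar>h' r\<bar>" using r0 nx by (simp add: q_def)
  have P: "0 < P" using p by (simp add: P_def)
  have M0: "0 \<le> M" using M[of r] r by auto
  have B0: "0 \<le> ?B" using a A by simp
  have Pq: "P * \<bar>q\<bar> = \<bar>h' r\<bar> powr (1 + \<alpha>) / r"
    using p r0 by (simp add: P_def q_def powr_add)
  have "((\<lambda>x :: real ^ 'n. norm x) \<longlongrightarrow> r) (nhds x0)"
    unfolding nx[symmetric] by (intro tendsto_intros filterlim_ident)
  with min have "\<forall>\<^sub>F x in nhds x0. u r - h r \<le> u (norm x) - h (norm x)"
    by (rule eventually_compose_filterlim)
  moreover have "\<forall>\<^sub>F x in nhds x0. x \<in> \<Omega>" by (rule eventually_nhds_in_open[OF open_\<Omega> x0(1)])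
  ultimately have min': "\<forall>\<^sub>F x in nhds x0. v x0 - h (norm (x0 - 0)) \<le> v x - h (norm (x - 0))"
    by eventually_elim (use radial[OF x0(1)] nx in \<open>simp add: radial\<close>)
  have Y: "a * P * Y \<le> M + ?B * (P * \<bar>q\<bar>)" if "Y < X" for Y
  proof (cases "q \<le> Y")
    case True
    have "F x0 (q *\<^sub>R x0) (radial_hessian x0 q Y) \<le> f r"
      using radial_test[OF x0, of h h' X Y] h X p min' that by (simp add: nx q_def)
    also have "f r \<le> M" using M[of r] r by auto
    finally show ?thesis
      using radial_operator_lower_bound[OF x0 q True] unfolding nq P_def[symmetric]
      by (simp add: mult.assoc)
  next
    case False
    then have "a * P * Y \<le> a * P * \<bar>q\<bar>" using a P by (intro mult_left_mono) auto
    also have "\<dots> \<le> M + ?B * (P * \<bar>q\<bar>)" using M0 A P by (simp add: algebra_simps)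
    finally show ?thesis .
  qed
  let ?w = "\<bar>h' r\<bar> powr (1 + \<alpha>) / c"
  have "P * \<bar>q\<bar> \<le> ?w" unfolding Pq using r c by (intro divide_left_mono) auto
  then have "M + ?B * (P * \<bar>q\<bar>) \<le> M + ?B * ?w" using B0 by (intro add_left_mono mult_left_mono)
  also have "\<dots> \<le> (M + ?B) * (1 + ?w)"
  proof -
    have "0 \<le> ?B + M * ?w" using B0 M0 c by simp
    then show ?thesis by (simp only: distrib_left distrib_right mult_1_right)
  qed
  finally have le: "M + ?B * (P * \<bar>q\<bar>) \<le> (M + ?B) * (1 + ?w)" .
  have "X \<le> (M + ?B) * (1 + ?w) / (a * P)"
    by (rule dense_le) (use Y le a P in \<open>fastforce simp: pos_le_divide_eq mult_ac\<close>)
  then show "\<bar>h' r\<bar> powr \<alpha> * X \<le> (M + ?B) / a * (1 + ?w)"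
    unfolding P_def[symmetric] using a P by (simp add: pos_le_divide_eq) (simp add: field_simps)
qed

text \<open>All eigenvalues of the Hessian of \<open>\<bar>x - z\<bar>\<^bsup>1+\<beta>\<^esup>\<close> are positive, so this works without loss
  in the singular term \<open>u' / r\<close>. The exponent is the one for which \<open>\<bar>\<psi>'\<bar>\<^sup>\<alpha> \<psi>''\<close> is constant, and the
  coefficient makes \<open>a \<bar>\<psi>'\<bar>\<^sup>\<alpha> \<psi>'' / 2\<close> equal to \<open>M + 1\<close>.\<close>

lemma barrier_not_touching:
  fixes z :: "real ^ 'n"
  assumes x: "x \<in> \<Omega>" "x \<noteq> z" and f: "f (norm x) \<le> M" and M: "0 \<le> M"
  defines "\<beta> \<equiv> 1 / (1 + \<alpha>)"
  defines "y \<equiv> (2 * (M + 1) * (1 + \<alpha>) / a) powr \<beta>"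
  defines "\<psi> \<equiv> \<lambda>s. y / (1 + \<beta>) * s powr (1 + \<beta>)"
  shows "\<not> (\<forall>\<^sub>F x' in nhds x. v x - \<psi> (norm (x - z)) \<le> v x' - \<psi> (norm (x' - z)))"
proof
  assume min: "\<forall>\<^sub>F x' in nhds x. v x - \<psi> (norm (x - z)) \<le> v x' - \<psi> (norm (x' - z))"
  define r where "r = norm (x - z)"
  have r: "r > 0" using x by (simp add: r_def)
  have \<beta>: "0 < \<beta>" "\<beta> * (1 + \<alpha>) = 1" using \<alpha> by (auto simp: \<beta>_def)
  have base: "0 < 2 * (M + 1) * (1 + \<alpha>) / a" using M \<alpha> a by simp
  have y: "0 < y" unfolding y_def using base by (simp only: powr_gt_zero)
  have y': "y powr (1 + \<alpha>) = 2 * (M + 1) * (1 + \<alpha>) / a"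
    unfolding y_def powr_powr \<beta> by (rule powr_one[OF less_imp_le[OF base]])
  define h' where "h' s = y * s powr \<beta>" for s
  define X where "X = y * (\<beta> * r powr (\<beta> - 1))"
  have "\<forall>\<^sub>F s in nhds r. s \<in> {0<..}" using r by (intro eventually_nhds_in_open) auto
  then have h: "\<forall>\<^sub>F s in nhds r. (\<psi> has_real_derivative h' s) (at s)"
  proof eventually_elim
    case (elim s)
    then have "((\<lambda>s. s powr (1 + \<beta>)) has_real_derivative (1 + \<beta>) * s powr \<beta>) (at s)"
      by (auto intro!: derivative_eq_intros)
    from DERIV_cmult[OF this, of "y / (1 + \<beta>)"] \<beta>(1) show ?case by (simp add: \<psi>_def h'_def)
  qed
  have "((\<lambda>s. s powr \<beta>) has_real_derivative \<beta> * r powr (\<beta> - 1)) (at r)"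
    using r by (auto intro!: derivative_eq_intros)
  then have X: "(h' has_real_derivative X) (at r)"
    unfolding h'_def[abs_def] X_def by (rule DERIV_cmult)
  have p: "0 < h' r" using y r by (simp add: h'_def)
  have X0: "0 < X" using y r \<beta> by (simp add: X_def)
  define q where "q = h' r / r"
  have q: "0 < q" using p r by (simp add: q_def)
  have nz: "x - z \<noteq> 0" using x by simp
  have psd: "radial_hessian (x - z) q (X / 2) \<in> psd_matrices"
    using psd_radial_hessian[OF nz] q X0 by simp
  have nq: "norm (q *\<^sub>R (x - z)) = h' r" using r p by (simp add: q_def r_def[symmetric])
  have qx: "q *\<^sub>R (x - z) \<noteq> 0" using q nz by simp
  have "M + 1 = a * h' r powr \<alpha> * (X / 2)"
  proof -
    have "h' r powr \<alpha> * X = (y powr \<alpha> * y) * \<beta> * (r powr (\<beta> * \<alpha>) * r powr (\<beta> - 1))"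
      using y r by (simp add: h'_def X_def powr_mult powr_powr)
    also have "r powr (\<beta> * \<alpha>) * r powr (\<beta> - 1) = 1"
      unfolding powr_add[symmetric] using r \<beta> by (simp add: algebra_simps)
    also have "y powr \<alpha> * y = y powr (1 + \<alpha>)" using y by (simp add: powr_add)
    also have "y powr (1 + \<alpha>) * \<beta> * 1 = 2 * (M + 1) / a * ((1 + \<alpha>) * \<beta>)" unfolding y' by simp
    also have "(1 + \<alpha>) * \<beta> = 1" using \<beta> by (simp add: mult.commute)
    finally have "a * (h' r powr \<alpha> * X) = 2 * (M + 1)" using a by simp
    then show ?thesis by (simp add: algebra_simps)
  qed
  also have "\<dots> \<le> a * h' r powr \<alpha> * trace (radial_hessian (x - z) q (X / 2))"
  proof -
    have "0 \<le> (real CARD('n) - 1) * q" using q by (simp add: Suc_leI)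
    then show ?thesis using a X0 by (intro mult_left_mono) (auto simp: trace_radial_hessian[OF nz])
  qed
  also have "\<dots> \<le> F x (q *\<^sub>R (x - z)) (0 + radial_hessian (x - z) q (X / 2)) - F x (q *\<^sub>R (x - z)) 0"
    using elliptic[OF x(1) qx zero_sym psd] unfolding nq by blast
  also have "\<dots> = F x (q *\<^sub>R (x - z)) (radial_hessian (x - z) q (X / 2))"
    using zero[OF x(1) qx] by simp
  also have "\<dots> \<le> f (norm x)"
    using radial_test[OF x, of \<psi> h' X "X / 2"] h X p min X0 by (simp add: q_def r_def)
  finally show False using f by simp
qed

text \<open>If \<open>u\<close> rose faster, the minimum over the closed ball of \<open>v\<close> minus the barrier centred at \<open>z\<close>
  would be attained at \<open>z\<close>, both for \<open>z = 0\<close> and for every small \<open>z\<close>. Comparing the values at \<open>0\<close> and at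
  one such \<open>z \<noteq> 0\<close> gives a contradiction, as for the one-dimensional barrier.\<close>

lemma growth_at_origin:
  assumes s: "0 < s" "cball 0 s \<subseteq> \<Omega>"
    and radial: "\<And>x. x \<in> \<Omega> \<Longrightarrow> v x = u (norm x)"
    and f: "\<And>r. 0 \<le> r \<Longrightarrow> r \<le> s \<Longrightarrow> f r \<le> M" and M: "0 \<le> M"
  defines "\<beta> \<equiv> 1 / (1 + \<alpha>)"
  shows "u s - u 0 \<le> (2 * (M + 1) * (1 + \<alpha>) / a) powr \<beta> / (1 + \<beta>) * s powr (1 + \<beta>)"
proof (rule ccontr)
  define k where "k = (2 * (M + 1) * (1 + \<alpha>) / a) powr \<beta> / (1 + \<beta>)"
  define \<psi> where "\<psi> s = k * s powr (1 + \<beta>)" for s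
  have \<beta>: "0 < \<beta>" using \<alpha> by (auto simp: \<beta>_def)
  have "0 < 2 * (M + 1) * (1 + \<alpha>) / a" using M \<alpha> a by simp
  then have k: "0 < k" unfolding k_def using \<beta> by (intro divide_pos_pos) (simp_all only: powr_gt_zero)
  have \<psi>0: "\<psi> 0 = 0" by (simp add: \<psi>_def)
  have \<psi>_mono: "\<psi> t \<le> \<psi> t'" if "0 \<le> t" "t \<le> t'" for t t'
    unfolding \<psi>_def using that k \<beta> by (intro mult_left_mono powr_mono2) auto
  assume "\<not> ?thesis"
  then have "u 0 < u s - \<psi> (s + 0)" by (simp add: k_def \<psi>_def)
  moreover have "((\<lambda>e. u s - \<psi> (s + e)) \<longlongrightarrow> u s - \<psi> (s + 0)) (at_right 0)"
    unfolding \<psi>_def using s by (intro tendsto_intros) auto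
  ultimately have "\<forall>\<^sub>F e in at_right 0. u 0 < u s - \<psi> (s + e)" by (rule order_tendstoD(1)[rotated])
  moreover have "\<forall>\<^sub>F e in at_right 0. e \<in> {0<..<s}" using s by (intro eventually_at_right_real)
  ultimately have "\<forall>\<^sub>F e in at_right 0. u 0 < u s - \<psi> (s + e) \<and> e \<in> {0<..<s}"
    by (rule eventually_conj)
  then obtain e where e: "u 0 < u s - \<psi> (s + e)" "0 < e" "e < s"
    using eventually_happens'[OF trivial_limit_at_right_real] by fastforce
  have 0: "(0 :: real ^ 'n) \<in> \<Omega>" using s by auto
  have min: "z \<in> cball 0 s \<and> (\<forall>x\<in>cball 0 s. v z \<le> v x - \<psi> (norm (x - z)))"
    if z: "norm z \<le> e" for z :: "real ^ 'n"
  proof -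
    have "continuous_on (cball 0 s) (\<lambda>x. v x - \<psi> (norm (x - z)))"
      unfolding \<psi>_def using \<beta>
      by (intro continuous_on_diff continuous_on_subset[OF cont s(2)] continuous_on_mult
          continuous_on_powr' continuous_intros) auto
    then obtain x where x: "x \<in> cball 0 s"
      and le: "\<And>y. y \<in> cball 0 s \<Longrightarrow> v x - \<psi> (norm (x - z)) \<le> v y - \<psi> (norm (y - z))"
      using continuous_attains_inf[of "cball 0 s" "\<lambda>x. v x - \<psi> (norm (x - z))"] s by auto
    have "norm x \<noteq> s"
    proof
      assume xs: "norm x = s"
      have "norm (x - z) \<le> s + e" using norm_triangle_ineq4[of x z] xs z by simp
      then have "u 0 < u s - \<psi> (norm (x - z))" using e \<psi>_mono[of "norm (x - z)" "s + e"] by simp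
      also have "\<dots> = v x - \<psi> (norm (x - z))" using radial[of x] x s xs by auto
      also have "\<dots> \<le> v 0 - \<psi> (norm (0 - z))" using le[of 0] s by auto
      also have "\<dots> \<le> u 0" using radial[OF 0] \<psi>_mono[of 0 "norm (0 - z)"] \<psi>0 by simp
      finally show False by simp
    qed
    then have xb: "x \<in> ball 0 s" using x by simp
    then have "\<forall>\<^sub>F y in nhds x. y \<in> ball 0 s" by (intro eventually_nhds_in_open) auto
    then have ev: "\<forall>\<^sub>F y in nhds x. v x - \<psi> (norm (x - z)) \<le> v y - \<psi> (norm (y - z))"
      by eventually_elim (use le in auto)
    have "x = z"
    proof (rule ccontr)
      assume "x \<noteq> z"
      with barrier_not_touching[of x z M] ev x s f[of "norm x"] M show False
        by (auto simp: \<psi>_def k_def \<beta>_def)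
    qed
    then show ?thesis using x le \<psi>0 by auto
  qed
  define z :: "real ^ 'n" where "z = e *\<^sub>R axis undefined 1"
  have nz: "norm z = e" using e by (simp add: z_def norm_axis_1)
  have "v 0 \<le> v z - \<psi> e" using min[of 0] min[of z] nz e by fastforce
  moreover have "v z \<le> v 0 - \<psi> e"
  proof -
    have "\<forall>x\<in>cball 0 s. v z \<le> v x - \<psi> (norm (x - z))" using min[of z] nz by auto
    from bspec[OF this, of 0] show ?thesis using s nz by simp
  qed
  moreover have "\<psi> e > 0" using k e by (simp add: \<psi>_def)
  ultimately show False by simp
qed

end

text \<open>Where \<open>v\<close> is locally constant, a test function touching it from below has a local maximum and
  hence zero gradient there, so that the second alternative of the definition holds vacuously.\<close>

lemma supersolution_tested:
  fixes \<Omega> :: "(real ^ 'n) set"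
  assumes op: "open \<Omega>" and v: "viscosity_supersolution \<Omega> F f v" and x0: "x\<^sub>0 \<in> \<Omega>"
    and C2: "C2_on \<Omega> \<phi> g H" and min: "local_min_at \<Omega> (\<lambda>x. v x - \<phi> x) x\<^sub>0" and g: "g x\<^sub>0 \<noteq> 0"
  shows "F x\<^sub>0 (g x\<^sub>0) (H x\<^sub>0) \<le> f (norm x\<^sub>0)"
proof -
  have False if d: "d > 0" "ball x\<^sub>0 d \<subseteq> \<Omega>" "v constant_on ball x\<^sub>0 d" for d
  proof -
    obtain e where e: "e > 0" "\<And>x. x \<in> \<Omega> \<inter> ball x\<^sub>0 e \<Longrightarrow> v x\<^sub>0 - \<phi> x\<^sub>0 \<le> v x - \<phi> x"
      using min unfolding local_min_at_def by blast
    have "v x = v x\<^sub>0" if "x \<in> ball x\<^sub>0 d" for x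
      using d that unfolding constant_on_def by (metis centre_in_ball)
    then have "\<forall>x\<in>ball x\<^sub>0 (min d e). \<phi> x \<le> \<phi> x\<^sub>0"
      using e(2) d(2) by fastforce
    moreover have "(\<phi> has_derivative (\<lambda>h. h \<bullet> g x\<^sub>0)) (at x\<^sub>0)"
      using C2 x0 unfolding C2_on_def gderiv_def by blast
    ultimately have "(\<lambda>h. h \<bullet> g x\<^sub>0) = (\<lambda>h. 0)"
      using d e by (intro differential_zero_maxmin[of x\<^sub>0 "ball x\<^sub>0 (min d e)" \<phi>]) auto
    then have "g x\<^sub>0 \<bullet> g x\<^sub>0 = 0" by meson
    then show False using g by simp
  qed
  then show ?thesis
    using v x0 C2 min g unfolding viscosity_supersolution_def by blast
qed

text \<open>Reflection in the values turns the upper bounds for subsolutions into the lower bounds for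
  supersolutions of an operator with the same ellipticity constants.\<close>

lemma subsolution_uminus:
  fixes \<Omega> :: "(real ^ 'n) set"
  assumes v: "viscosity_subsolution \<Omega> F f v"
  shows "viscosity_supersolution \<Omega> (\<lambda>x p M. - F x (- p) (- M)) (\<lambda>r. - f r) (\<lambda>x. - v x)"
proof -
  have C2: "C2_on \<Omega> (\<lambda>x. - \<phi> x) (\<lambda>x. - g x) (\<lambda>x. - H x)" if "C2_on \<Omega> \<phi> g H"
    for \<phi> and g :: "real ^ 'n \<Rightarrow> real ^ 'n" and H
  proof -
    have "(*v) (- M) = (\<lambda>h. - (M *v h))" for M :: "real ^ 'n ^ 'n"
      by (simp add: matrix_vector_mult_def vec_eq_iff sum_negf fun_eq_iff)
    then show ?thesis
      using that unfolding C2_on_def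
      by (auto intro!: GDERIV_minus continuous_on_minus intro: has_derivative_minus)
  qed
  have max: "local_max_at \<Omega> (\<lambda>x. v x - - \<phi> x) x\<^sub>0" if "local_min_at \<Omega> (\<lambda>x. - v x - \<phi> x) x\<^sub>0" for \<phi> x\<^sub>0
    using that unfolding local_min_at_def local_max_at_def by (fastforce simp: algebra_simps)
  have neg_const: "(\<lambda>x. - v x) constant_on S" if "v constant_on S" for S
    using that unfolding constant_on_def by auto
  show ?thesis
    unfolding viscosity_supersolution_def
  proof (intro conjI ballI)
    show "continuous_on \<Omega> (\<lambda>x. - v x)"
      using v unfolding viscosity_subsolution_def by (intro continuous_on_minus) auto
  next
    fix x\<^sub>0 assume "x\<^sub>0 \<in> \<Omega>"
    then consider (const) d where "d > 0" "ball x\<^sub>0 d \<subseteq> \<Omega>" "v constant_on ball x\<^sub>0 d"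
        "\<forall>x\<in>ball x\<^sub>0 d. 0 \<ge> f (norm x)"
      | (test) "\<And>\<phi> g H. C2_on \<Omega> \<phi> g H \<Longrightarrow> local_max_at \<Omega> (\<lambda>x. v x - \<phi> x) x\<^sub>0 \<Longrightarrow>
           g x\<^sub>0 \<noteq> 0 \<Longrightarrow> F x\<^sub>0 (g x\<^sub>0) (H x\<^sub>0) \<ge> f (norm x\<^sub>0)"
      using v unfolding viscosity_subsolution_def by blast
    then show "(\<exists>\<delta>>0. ball x\<^sub>0 \<delta> \<subseteq> \<Omega> \<and> (\<lambda>x. - v x) constant_on ball x\<^sub>0 \<delta> \<and>
           (\<forall>x\<in>ball x\<^sub>0 \<delta>. 0 \<le> - f (norm x))) \<or>
        (\<forall>\<phi> g H. C2_on \<Omega> \<phi> g H \<longrightarrow> local_min_at \<Omega> (\<lambda>x. - v x - \<phi> x) x\<^sub>0 \<longrightarrow>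
           g x\<^sub>0 \<noteq> 0 \<longrightarrow> - F x\<^sub>0 (- g x\<^sub>0) (- H x\<^sub>0) \<le> - f (norm x\<^sub>0))"
    proof cases
      case const
      then show ?thesis using const neg_const by (intro disjI1 exI[of _ d]) auto
    next
      case test
      show ?thesis
        using test[OF C2 max] by (intro disjI2 allI impI) auto
    qed
  qed
qed

section \<open>Regularity of radial solutions\<close>

lemma C1_holder_of_flux:
  assumes \<alpha>: "\<alpha> \<ge> 0"
    and D: "\<And>r. r \<in> I \<Longrightarrow> (u has_real_derivative u' r) (at r within I)"
    and L: "\<And>r. r \<in> I \<Longrightarrow> \<exists>\<delta>>0. \<exists>L. \<forall>s\<in>I \<inter> ball r \<delta>. \<forall>t\<in>I \<inter> ball r \<delta>.
      \<bar>signed_powr (1 + \<alpha>) (u' s) - signed_powr (1 + \<alpha>) (u' t)\<bar> \<le> L * \<bar>s - t\<bar>"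
  shows "C1_holder_on (1 / (1 + \<alpha>)) I u"
proof -
  define \<beta> where "\<beta> = 1 / (1 + \<alpha>)"
  have \<beta>: "0 < \<beta>" "\<beta> \<le> 1" "\<beta> * (1 + \<alpha>) = 1" using \<alpha> by (auto simp: \<beta>_def)
  have holder: "\<exists>\<delta>>0. \<exists>C. \<forall>s\<in>I \<inter> ball r \<delta>. \<forall>t\<in>I \<inter> ball r \<delta>. \<bar>u' s - u' t\<bar> \<le> C * \<bar>s - t\<bar> powr \<beta>"
    if r: "r \<in> I" for r
  proof -
    obtain \<delta> L where d: "\<delta> > 0" and L: "\<And>s t. s \<in> I \<inter> ball r \<delta> \<Longrightarrow> t \<in> I \<inter> ball r \<delta> \<Longrightarrow>
        \<bar>signed_powr (1 + \<alpha>) (u' s) - signed_powr (1 + \<alpha>) (u' t)\<bar> \<le> L * \<bar>s - t\<bar>"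
      using L[OF r] by blast
    have "\<bar>u' s - u' t\<bar> \<le> 2 * \<bar>L\<bar> powr \<beta> * \<bar>s - t\<bar> powr \<beta>"
      if st: "s \<in> I \<inter> ball r \<delta>" "t \<in> I \<inter> ball r \<delta>" for s t
    proof -
      have "L * \<bar>s - t\<bar> \<le> \<bar>L\<bar> * \<bar>s - t\<bar>" by (intro mult_right_mono) auto
      then have le: "\<bar>signed_powr (1 + \<alpha>) (u' s) - signed_powr (1 + \<alpha>) (u' t)\<bar> \<le> \<bar>L\<bar> * \<bar>s - t\<bar>"
        using L[OF st] by linarith
      have "\<bar>u' s - u' t\<bar> = \<bar>signed_powr \<beta> (signed_powr (1 + \<alpha>) (u' s)) - signed_powr \<beta> (signed_powr (1 + \<alpha>) (u' t))\<bar>"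
        using \<beta>(3) by (simp add: signed_powr_inverse)
      also have "\<dots> \<le> 2 * \<bar>signed_powr (1 + \<alpha>) (u' s) - signed_powr (1 + \<alpha>) (u' t)\<bar> powr \<beta>"
        by (rule signed_powr_holder[OF \<beta>(1,2)])
      also have "\<dots> \<le> 2 * (\<bar>L\<bar> * \<bar>s - t\<bar>) powr \<beta>"
        using le \<beta> by (intro mult_left_mono powr_mono2) auto
      finally show ?thesis by (simp add: powr_mult)
    qed
    then show ?thesis using d by blast
  qed
  have "continuous_on I u'"
    unfolding continuous_on_def
  proof
    fix r assume r: "r \<in> I"
    obtain \<delta> C where d: "\<delta> > 0" and C: "\<And>s t. s \<in> I \<inter> ball r \<delta> \<Longrightarrow> t \<in> I \<inter> ball r \<delta> \<Longrightarrow>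
        \<bar>u' s - u' t\<bar> \<le> C * \<bar>s - t\<bar> powr \<beta>"
      using holder[OF r] by blast
    have "\<forall>\<^sub>F s in at r within I. s \<in> I \<inter> ball r \<delta>"
      unfolding eventually_at using d by (auto simp: dist_commute)
    then have "\<forall>\<^sub>F s in at r within I. norm (u' s - u' r) \<le> C * \<bar>s - r\<bar> powr \<beta>"
      by eventually_elim (use C[of _ r] r d in auto)
    moreover have "((\<lambda>s. C * \<bar>s - r\<bar> powr \<beta>) \<longlongrightarrow> C * \<bar>r - r\<bar> powr \<beta>) (at r within I)"
      using \<beta> by (intro tendsto_intros) auto
    then have "((\<lambda>s. C * \<bar>s - r\<bar> powr \<beta>) \<longlongrightarrow> 0) (at r within I)" by simp
    ultimately have "((\<lambda>s. u' s - u' r) \<longlongrightarrow> 0) (at r within I)"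
      by (rule Lim_null_comparison)
    then show "(u' \<longlongrightarrow> u' r) (at r within I)" by (simp add: LIM_zero_iff)
  qed
  then show ?thesis
    unfolding C1_holder_on_def \<beta>_def[symmetric] using D holder by blast
qed

text \<open>If \<open>t\<close> exceeds \<open>2 s\<close>, both values are controlled by \<open>L t\<close>, which is comparable to \<open>t - s\<close>.\<close>

lemma lipschitz_up_to_zero:
  fixes W :: "real \<Rightarrow> real"
  assumes W: "\<And>s. 0 < s \<Longrightarrow> s < \<delta> \<Longrightarrow> \<bar>W s\<bar> \<le> L * s" and W0: "W 0 = 0"
    and near: "\<And>s t. 0 < s \<Longrightarrow> s \<le> t \<Longrightarrow> t \<le> 2 * s \<Longrightarrow> t < \<delta> \<Longrightarrow> \<bar>W s - W t\<bar> \<le> L * (t - s)"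
    and st: "s \<in> {0..<\<delta>}" "t \<in> {0..<\<delta>}"
  shows "\<bar>W s - W t\<bar> \<le> 3 * L * \<bar>s - t\<bar>"
proof -
  have main: "\<bar>W s - W t\<bar> \<le> 3 * L * (t - s)" if "0 \<le> s" "s < t" "t < \<delta>" for s t
  proof -
    have "0 \<le> L * t" using W[of t] that by linarith
    then have L: "0 \<le> L" using that by (simp add: zero_le_mult_iff)
    show ?thesis
    proof (cases "t \<le> 2 * s")
      case True
      then have "\<bar>W s - W t\<bar> \<le> L * (t - s)" using near[of s t] that by auto
      also have "\<dots> \<le> 3 * L * (t - s)" using L that by (intro mult_right_mono) auto
      finally show ?thesis .
    next
      case False
      have "\<bar>W s\<bar> \<le> L * s" using W[of s] W0 that by (cases "s = 0") auto
      then have "\<bar>W s - W t\<bar> \<le> L * (s + t)"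
        using W[of t] that by (simp add: distrib_left)
      also have "\<dots> \<le> L * (3 * (t - s))" using L False by (intro mult_left_mono) auto
      also have "\<dots> = 3 * L * (t - s)" by (simp only: mult_ac)
      finally show ?thesis .
    qed
  qed
  show ?thesis
    using main[of s t] main[of t s] st
    by (cases s t rule: linorder_cases) (auto simp: abs_minus_commute)
qed

text \<open>A radial function for which both \<open>v\<close> and \<open>-v\<close> are supersolutions; \<open>u\<close> is its radial profile
  and \<open>I\<close> the set of radii.\<close>

locale elliptic_radial_solution =
  sup: elliptic_supersolution \<Omega> F \<alpha> a A f v +
  sub: elliptic_supersolution \<Omega> "\<lambda>x p M. - F x (- p) (- M)" \<alpha> a A "\<lambda>r. - f r" "\<lambda>x. - v x"
  for \<Omega> :: "(real ^ 'n) set" and F \<alpha> a A f v +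
  fixes I :: "real set" and u :: "real \<Rightarrow> real"
  assumes \<Omega>_iff: "x \<in> \<Omega> \<longleftrightarrow> norm x \<in> I"
    and v_eq: "x \<in> \<Omega> \<Longrightarrow> v x = u (norm x)"
    and f_cont: "continuous_on I f"
begin

definition flux :: "real \<Rightarrow> real" where
  "flux r = signed_powr (1 + \<alpha>) (deriv u r)"

lemma continuous_profile:
  assumes "S \<subseteq> I" "S \<subseteq> {0..}"
  shows "continuous_on S u"
proof -
  let ?e = "axis undefined 1 :: real ^ 'n"
  have n: "norm (r *\<^sub>R ?e) = r" if "r \<in> S" for r
    using assms that by (auto simp: norm_axis_1)
  have "continuous_on S (\<lambda>r. v (r *\<^sub>R ?e))"
    by (rule continuous_on_compose2[OF sup.cont])
      (use assms n in \<open>auto intro!: continuous_intros simp: \<Omega>_iff\<close>)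
  then show ?thesis
    by (rule continuous_on_eq) (use n assms in \<open>auto simp: v_eq \<Omega>_iff\<close>)
qed

lemma flux_estimates:
  assumes c: "0 < c" "{c<..<d} \<subseteq> I" and M: "\<And>r. c < r \<Longrightarrow> r < d \<Longrightarrow> \<bar>f r\<bar> \<le> M"
  defines "C \<equiv> (M + (A * real CARD('n) + a)) / a"
  assumes st0: "s\<^sub>0 \<in> {c<..<d}" "t\<^sub>0 \<in> {c<..<d}" "s\<^sub>0 \<noteq> t\<^sub>0"
    and B: "barrier.K \<alpha> C * (\<bar>barrier.offset \<alpha> C c (chord u s\<^sub>0 t\<^sub>0)\<bar> + 3 * (d - c)) / c \<le> B"
    and J: "s \<in> {c<..<d}" "t \<in> {c<..<d}"
  shows "(u has_real_derivative deriv u s) (at s)"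
    and "\<bar>flux s\<bar> \<le> c * sinh B"
    and "\<bar>flux s - flux t\<bar> \<le> 2 * barrier.K \<alpha> C * cosh B * \<bar>s - t\<bar>"
proof -
  have "0 \<le> M" using M[of s] J by auto
  then have "0 \<le> C" unfolding C_def using sup.a sup.A by simp
  then interpret bar: barrier \<alpha> C c using sup.\<alpha> c by unfold_locales
  have annulus: "x \<in> \<Omega>" if "c < norm x" "norm x < d" for x
    using that c \<Omega>_iff by auto
  have below: "touch_bound \<alpha> C c {c<..<d} u"
    unfolding C_def by (rule sup.touch_bound_radial[OF c(1) annulus v_eq M])
  have above: "touch_bound \<alpha> C c {c<..<d} (\<lambda>r. - u r)"
    unfolding C_def by (rule sub.touch_bound_radial[OF c(1) annulus]) (use v_eq M in auto)
  have cont: "continuous_on {c<..<d} u"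
    using c by (intro continuous_profile) auto
  note est = bar.flux_estimates[OF below above cont st0 B J]
  show "(u has_real_derivative deriv u s) (at s)"
    and "\<bar>flux s\<bar> \<le> c * sinh B"
    and "\<bar>flux s - flux t\<bar> \<le> 2 * barrier.K \<alpha> C * cosh B * \<bar>s - t\<bar>"
    using est unfolding flux_def by auto
qed

text \<open>Shrinking the interval makes \<open>f\<close> bounded; the length scale is the left end point of the
  shrunk interval.\<close>

lemma interior_regularity:
  assumes J: "{c<..<d} \<subseteq> I" "0 < c" and r: "r \<in> {c<..<d}"
  shows "(u has_real_derivative deriv u r) (at r)"
    and "\<exists>\<delta>>0. \<exists>L. \<forall>s\<in>ball r \<delta>. \<forall>t\<in>ball r \<delta>. \<bar>flux s - flux t\<bar> \<le> L * \<bar>s - t\<bar>"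
proof -
  define c' d' where "c' = (c + r) / 2" and "d' = (r + d) / 2"
  have cd: "c < c'" "c' < r" "r < d'" "d' < d" using r by (auto simp: c'_def d'_def)
  have sub: "{c'..d'} \<subseteq> I" using cd J by (auto simp: subset_iff)
  have "bounded (f ` {c'..d'})"
    by (intro compact_imp_bounded compact_continuous_image continuous_on_subset[OF f_cont sub]) auto
  then obtain M where "\<forall>y\<in>f ` {c'..d'}. norm y \<le> M" unfolding bounded_iff by blast
  then have M: "\<bar>f s\<bar> \<le> M" if "s \<in> {c'..d'}" for s using that by auto
  define t0 where "t0 = (r + d') / 2"
  have t0: "t0 \<in> {c'<..<d'}" "r \<noteq> t0" and r': "r \<in> {c'<..<d'}" using cd by (auto simp: t0_def)
  have c': "0 < c'" "{c'<..<d'} \<subseteq> I" using cd J sub by (auto simp: subset_iff)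
  have M': "\<bar>f s\<bar> \<le> M" if "c' < s" "s < d'" for s using M[of s] that by auto
  note est = flux_estimates[OF c' M' r' t0 order_refl]
  show "(u has_real_derivative deriv u r) (at r)"
    by (rule est(1)[OF _ _ r' r'])
  define \<delta> where "\<delta> = min (r - c') (d' - r)"
  have "\<delta> > 0" using cd by (simp add: \<delta>_def)
  moreover have "ball r \<delta> \<subseteq> {c'<..<d'}" by (auto simp: \<delta>_def dist_real_def)
  ultimately show "\<exists>\<delta>>0. \<exists>L. \<forall>s\<in>ball r \<delta>. \<forall>t\<in>ball r \<delta>. \<bar>flux s - flux t\<bar> \<le> L * \<bar>s - t\<bar>"
    using est(3) by (meson subsetD)
qed

text \<open>Near the origin the length scale must tend to zero with \<open>c\<close>. The growth bound says that the
  chord from \<open>2 c\<close> to \<open>4 c\<close> has flux of order \<open>c\<close>, so on the interval \<open>(c, 6 c)\<close>, whose length is a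
  fixed multiple of \<open>c\<close>, the constant \<open>B\<close> of the flux estimates does not depend on \<open>c\<close>.\<close>

lemma origin_regularity:
  assumes R: "0 < R" "{0..<R} \<subseteq> I"
  obtains \<delta> L k where "0 < \<delta>" "\<delta> \<le> R"
    and "\<And>s. 0 < s \<Longrightarrow> s < \<delta> \<Longrightarrow> \<bar>u s - u 0\<bar> \<le> k * s powr (1 + 1 / (1 + \<alpha>))"
    and "\<And>s. 0 < s \<Longrightarrow> s < \<delta> \<Longrightarrow> \<bar>flux s\<bar> \<le> L * s"
    and "\<And>s t. 0 < s \<Longrightarrow> s \<le> t \<Longrightarrow> t \<le> 2 * s \<Longrightarrow> t < \<delta> \<Longrightarrow> \<bar>flux s - flux t\<bar> \<le> L * (t - s)"
proof -
  define \<beta> where "\<beta> = 1 / (1 + \<alpha>)"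
  have \<beta>: "0 < \<beta>" "\<beta> * (1 + \<alpha>) = 1" using sup.\<alpha> by (auto simp: \<beta>_def)
  have half: "{0..R/2} \<subseteq> I" using R by (auto simp: subset_iff)
  have "bounded (f ` {0..R/2})"
    by (intro compact_imp_bounded compact_continuous_image continuous_on_subset[OF f_cont half]) auto
  then obtain M where "\<forall>y\<in>f ` {0..R/2}. norm y \<le> M" unfolding bounded_iff by blast
  then have M: "\<bar>f s\<bar> \<le> M" if "0 \<le> s" "s \<le> R/2" for s using that by auto
  have M0: "0 \<le> M" using M[of 0] R by simp
  define k where "k = (2 * (M + 1) * (1 + \<alpha>) / a) powr \<beta> / (1 + \<beta>)"
  have k0: "0 \<le> k" using \<beta> by (simp add: k_def)
  have growth: "\<bar>u s - u 0\<bar> \<le> k * s powr (1 + \<beta>)" if s: "0 < s" "s \<le> R/2" for s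
  proof -
    have "cball 0 s \<subseteq> \<Omega>" using R s by (auto simp: \<Omega>_iff subset_iff)
    from sup.growth_at_origin[OF s(1) this v_eq _ M0] sub.growth_at_origin[OF s(1) this _ _ M0, of "\<lambda>r. - u r"]
    show ?thesis using M s v_eq
      by (force simp: k_def \<beta>_def abs_le_iff)
  qed
  define C where "C = (M + (A * real CARD('n) + a)) / a"
  have "0 \<le> C" unfolding C_def using M0 sup.a sup.A by simp
  define K where "K = barrier.K \<alpha> C"
  have K: "0 < K" unfolding K_def
    by (rule barrier.K_pos[of \<alpha> C 1]) (use \<open>0 \<le> C\<close> sup.\<alpha> in unfold_locales, auto)
  \<comment> \<open>\<open>b\<close> bounds the flux of the anchoring chord divided by \<open>c\<close>; the interval length \<open>5 c\<close> enters three times.\<close>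
  define b where "b = (4 * k) powr (1 + \<alpha>) * 4"
  define B where "B = arsinh b + 15 * K"
  have "0 \<le> b" by (simp add: b_def)
  then have "0 \<le> arsinh b" using arsinh_less_iff_real[of b 0] unfolding arsinh_0 by linarith
  then have B0: "0 \<le> B" using K by (simp add: B_def)
  have est: "\<bar>flux s\<bar> \<le> c * sinh B" "\<bar>flux s - flux t\<bar> \<le> 2 * K * cosh B * \<bar>s - t\<bar>"
    if c: "0 < c" "6 * c \<le> R / 2" and J: "s \<in> {c<..<6 * c}" "t \<in> {c<..<6 * c}" for c s t
  proof -
    interpret bar: barrier \<alpha> C c by unfold_locales (use sup.\<alpha> \<open>0 \<le> C\<close> c in auto)
    let ?q = "chord u (2 * c) (4 * c)"
    \<comment> \<open>The slope of this chord has the order of \<open>c\<^bsup>\<beta>\<^esup>\<close>, and \<open>\<beta> (1 + \<alpha>) = 1\<close> turns this into a flux of order \<open>c\<close>.\<close>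
    have "(2 * c) powr (1 + \<beta>) \<le> (4 * c) powr (1 + \<beta>)" using c \<beta> by (intro powr_mono2) auto
    then have "k * (2 * c) powr (1 + \<beta>) \<le> k * (4 * c) powr (1 + \<beta>)" using k0 by (rule mult_left_mono)
    then have "\<bar>u (4 * c) - u (2 * c)\<bar> \<le> 2 * (k * (4 * c) powr (1 + \<beta>))"
      using growth[of "4 * c"] growth[of "2 * c"] c by auto
    also have "(4 * c) powr (1 + \<beta>) = 4 * c * (4 * c) powr \<beta>" using c by (simp add: powr_add)
    finally have "\<bar>?q\<bar> \<le> 4 * k * (4 * c) powr \<beta>"
      using c by (simp add: chord_def pos_divide_le_eq mult_ac)
    then have "\<bar>?q\<bar> powr (1 + \<alpha>) \<le> (4 * k * (4 * c) powr \<beta>) powr (1 + \<alpha>)"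
      using sup.\<alpha> by (intro powr_mono2) auto
    also have "\<dots> = (4 * k) powr (1 + \<alpha>) * (4 * c)"
      using c k0 \<beta>(2) by (simp add: powr_mult powr_powr)
    finally have "K * \<bar>bar.offset ?q\<bar> / c \<le> arsinh b"
      unfolding K_def by (intro bar.offset_bound) (simp add: b_def)
    then have le: "barrier.K \<alpha> C * (\<bar>bar.offset ?q\<bar> + 3 * (6 * c - c)) / c \<le> B"
      using c by (simp add: B_def K_def add_divide_distrib distrib_left)
    have I: "{c<..<6 * c} \<subseteq> I" using c half by (auto simp: subset_iff)
    have M': "\<bar>f r\<bar> \<le> M" if "c < r" "r < 6 * c" for r using M[of r] that c by auto
    note est = flux_estimates[OF c(1) I M', of "2 * c" "4 * c" B s t, folded C_def]
    show "\<bar>flux s\<bar> \<le> c * sinh B" "\<bar>flux s - flux t\<bar> \<le> 2 * K * cosh B * \<bar>s - t\<bar>"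
      unfolding K_def using est(2,3) c J le by auto
  qed
  define L where "L = sinh B + 2 * K * cosh B"
  have sB: "0 \<le> sinh B" using B0 by simp
  have cB: "0 \<le> 2 * K * cosh B" using K by simp
  show thesis
  proof (rule that[of "R / 6" k L])
    fix s assume s: "0 < s" "s < R / 6"
    have "\<bar>flux s\<bar> \<le> s / 2 * sinh B"
      using est(1)[of "s / 2" s s] s by auto
    also have "\<dots> \<le> s * L" using s sB cB unfolding L_def by (intro mult_mono) auto
    finally show "\<bar>flux s\<bar> \<le> L * s" by (simp add: mult.commute)
  next
    fix s t assume st: "0 < s" "s \<le> t" "t \<le> 2 * s" "t < R / 6"
    have "\<bar>flux s - flux t\<bar> \<le> 2 * K * cosh B * \<bar>s - t\<bar>"
      using est(2)[of "s / 2" s t] st by auto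
    also have "\<dots> \<le> L * \<bar>s - t\<bar>" using sB unfolding L_def by (intro mult_right_mono) auto
    finally show "\<bar>flux s - flux t\<bar> \<le> L * (t - s)" using st by simp
  qed (use R growth in \<open>auto simp: \<beta>_def\<close>)
qed

lemma derivative_at_origin:
  assumes "0 < \<delta>"
    and g: "\<And>s. 0 < s \<Longrightarrow> s < \<delta> \<Longrightarrow> \<bar>u s - u 0\<bar> \<le> k * s powr (1 + 1 / (1 + \<alpha>))"
  shows "(u has_real_derivative 0) (at 0 within {0..<R})"
proof -
  have \<beta>: "0 < 1 / (1 + \<alpha>)" using sup.\<alpha> by simp
  have "\<forall>\<^sub>F s in at 0 within {0..<R}. s \<in> {0<..<\<delta>}"
    unfolding eventually_at using \<open>0 < \<delta>\<close> by (auto intro!: exI[of _ \<delta>])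
  then have "\<forall>\<^sub>F s in at 0 within {0..<R}. norm ((u s - u 0) / (s - 0)) \<le> k * s powr (1 / (1 + \<alpha>))"
  proof eventually_elim
    case (elim s)
    then have "\<bar>u s - u 0\<bar> / s \<le> k * s powr (1 + 1 / (1 + \<alpha>)) / s"
      using g[of s] by (intro divide_right_mono) auto
    also have "\<dots> = k * s powr (1 / (1 + \<alpha>))" using elim by (simp add: powr_add)
    finally show ?case using elim by simp
  qed
  moreover have "((\<lambda>s. k * s powr (1 / (1 + \<alpha>))) \<longlongrightarrow> k * 0 powr (1 / (1 + \<alpha>))) (at 0 within {0..<R})"
    using \<beta> by (intro tendsto_intros) (auto simp: eventually_at intro!: exI[of _ 1])
  then have "((\<lambda>s. k * s powr (1 / (1 + \<alpha>))) \<longlongrightarrow> 0) (at 0 within {0..<R})" by simp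
  ultimately have "((\<lambda>s. (u s - u 0) / (s - 0)) \<longlongrightarrow> 0) (at 0 within {0..<R})"
    by (rule Lim_null_comparison)
  then show ?thesis by (simp add: has_field_derivative_iff)
qed

lemma C1_holder_annulus:
  assumes I: "I = {R\<^sub>1<..<R\<^sub>2}" "0 \<le> R\<^sub>1"
  shows "C1_holder_on (1 / (1 + \<alpha>)) I u"
proof (rule C1_holder_of_flux[OF sup.\<alpha>, where u' = "deriv u"])
  fix r assume r: "r \<in> I"
  have J: "{(R\<^sub>1 + r) / 2<..<R\<^sub>2} \<subseteq> I" "0 < (R\<^sub>1 + r) / 2" "r \<in> {(R\<^sub>1 + r) / 2<..<R\<^sub>2}"
    using r I by (auto simp: subset_iff)
  note reg = interior_regularity[OF J]
  show "(u has_real_derivative deriv u r) (at r within I)"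
    using reg(1) has_field_derivative_at_within by blast
  show "\<exists>\<delta>>0. \<exists>L. \<forall>s\<in>I \<inter> ball r \<delta>. \<forall>t\<in>I \<inter> ball r \<delta>.
      \<bar>signed_powr (1 + \<alpha>) (deriv u s) - signed_powr (1 + \<alpha>) (deriv u t)\<bar> \<le> L * \<bar>s - t\<bar>"
    using reg(2) unfolding flux_def by blast
qed

lemma C1_holder_ball:
  assumes I: "I = {0..<R}" "0 < R"
  shows "C1_holder_on (1 / (1 + \<alpha>)) I u"
proof -
  obtain \<delta> L k where \<delta>: "0 < \<delta>" "\<delta> \<le> R"
    and k: "\<And>s. 0 < s \<Longrightarrow> s < \<delta> \<Longrightarrow> \<bar>u s - u 0\<bar> \<le> k * s powr (1 + 1 / (1 + \<alpha>))"
    and W: "\<And>s. 0 < s \<Longrightarrow> s < \<delta> \<Longrightarrow> \<bar>flux s\<bar> \<le> L * s"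
    and near: "\<And>s t. 0 < s \<Longrightarrow> s \<le> t \<Longrightarrow> t \<le> 2 * s \<Longrightarrow> t < \<delta> \<Longrightarrow> \<bar>flux s - flux t\<bar> \<le> L * (t - s)"
    by (rule origin_regularity[OF I(2) eq_refl[OF I(1)[symmetric]]]) (rule that)
  \<comment> \<open>At the end point \<open>0\<close> the derivative is one-sided, and \<open>deriv\<close>, which is two-sided, carries no information there.\<close>
  define u' where "u' r = (if r = 0 then 0 else deriv u r)" for r
  define W where "W r = signed_powr (1 + \<alpha>) (u' r)" for r
  have W_eq: "W r = flux r" if "r \<noteq> 0" for r using that by (simp add: W_def flux_def u'_def)
  have lip: "\<bar>W s - W t\<bar> \<le> 3 * L * \<bar>s - t\<bar>" if "s \<in> {0..<\<delta>}" "t \<in> {0..<\<delta>}" for s t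
    by (rule lipschitz_up_to_zero[OF _ _ _ that]) (use W near in \<open>auto simp: W_eq\<close>, simp add: W_def u'_def)
  have J: "{r / 2<..<R} \<subseteq> I" "0 < r / 2" "r \<in> {r / 2<..<R}" if "r \<in> I" "r \<noteq> 0" for r
    using that I by (auto simp: subset_iff)
  show ?thesis
  proof (rule C1_holder_of_flux[OF sup.\<alpha>, where u' = u'])
    fix r assume r: "r \<in> I"
    show "(u has_real_derivative u' r) (at r within I)"
    proof (cases "r = 0")
      case True
      then show ?thesis using derivative_at_origin[OF \<delta>(1) k] I by (simp add: u'_def)
    next
      case False
      then show ?thesis
        using interior_regularity(1)[OF J[OF r False]] has_field_derivative_at_within
        by (auto simp: u'_def)
    qed
    have "\<exists>\<delta>>0. \<exists>L. \<forall>s\<in>I \<inter> ball r \<delta>. \<forall>t\<in>I \<inter> ball r \<delta>. \<bar>W s - W t\<bar> \<le> L * \<bar>s - t\<bar>"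
    proof (cases "r = 0")
      case True
      have "I \<inter> ball r \<delta> \<subseteq> {0..<\<delta>}" using True I by auto
      then show ?thesis using lip \<delta>(1) by (meson subsetD)
    next
      case False
      then obtain e L where e: "e > 0" and L: "\<And>s t. s \<in> ball r e \<Longrightarrow> t \<in> ball r e \<Longrightarrow> \<bar>flux s - flux t\<bar> \<le> L * \<bar>s - t\<bar>"
        using interior_regularity(2)[OF J[OF r False]] by blast
      have "\<bar>W s - W t\<bar> \<le> L * \<bar>s - t\<bar>" if "s \<in> I \<inter> ball r (min e r)" "t \<in> I \<inter> ball r (min e r)" for s t
        using L[of s t] that by (auto simp: W_eq dist_real_def)
      moreover have "min e r > 0" using e False r I by auto
      ultimately show ?thesis by blast
    qed
    then show "\<exists>\<delta>>0. \<exists>L. \<forall>s\<in>I \<inter> ball r \<delta>. \<forall>t\<in>I \<inter> ball r \<delta>.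
        \<bar>signed_powr (1 + \<alpha>) (u' s) - signed_powr (1 + \<alpha>) (u' t)\<bar> \<le> L * \<bar>s - t\<bar>"
      unfolding W_def .
  qed
qed

end

theorem proposition4p4:
  fixes \<Omega> :: "(real ^ 'n) set" and I :: "real set"
    and F :: "real ^ 'n \<Rightarrow> real ^ 'n \<Rightarrow> real ^ 'n ^ 'n \<Rightarrow> real"
    and \<alpha> a A \<nu> \<kappa> :: real
    and f u :: "real \<Rightarrow> real" and v :: "real ^ 'n \<Rightarrow> real"
  assumes domain: "ball_or_annulus \<Omega> I"
    and F_cont: "continuous_on (\<Omega> \<times> (UNIV - {0}) \<times> sym_matrices) (\<lambda>(x, p, M). F x p M)"
    and alpha_a_A: "\<alpha> \<ge> 0" "a > 0" "A > 0"
    and F_homogeneous: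
      "\<And>x p M t \<mu>. x \<in> \<Omega> \<Longrightarrow> p \<noteq> 0 \<Longrightarrow> M \<in> sym_matrices \<Longrightarrow> t \<noteq> 0 \<Longrightarrow> \<mu> > 0 \<Longrightarrow>
         F x (t *\<^sub>R p) (\<mu> *\<^sub>R M) = \<bar>t\<bar> powr \<alpha> * \<mu> * F x p M"
    and F_elliptic:
      "\<And>x p M Q. x \<in> \<Omega> \<Longrightarrow> p \<noteq> 0 \<Longrightarrow> M \<in> sym_matrices \<Longrightarrow> Q \<in> psd_matrices \<Longrightarrow>
         a * norm p powr \<alpha> * trace Q \<le> F x p (M + Q) - F x p M \<and>
         F x p (M + Q) - F x p M \<le> A * norm p powr \<alpha> * trace Q"
    and F_invariant:
      "\<And>x p M U. x \<in> \<Omega> \<Longrightarrow> p \<noteq> 0 \<Longrightarrow> M \<in> sym_matrices \<Longrightarrow> orthogonal_matrix U \<Longrightarrow>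
         F (transpose U *v x) (transpose U *v p) (transpose U ** M ** U) = F x p M"
    and nu_kappa: "\<nu> > 0" "1/2 < \<kappa>" "\<kappa> \<le> 1"
    and F_holder:
      "\<And>x p q M. x \<in> \<Omega> \<Longrightarrow> norm p = 1 \<Longrightarrow> norm q \<le> 1/2 \<Longrightarrow> M \<in> sym_matrices \<Longrightarrow>
         \<bar>F x (p + q) M - F x p M\<bar> \<le> \<nu> * norm q powr \<kappa> * norm M"
    and f_cont: "continuous_on I f"
    and solution: "viscosity_solution \<Omega> F f v"
    and radial: "\<And>x. x \<in> \<Omega> \<Longrightarrow> v x = u (norm x)"
  shows "C1_holder_on (1 / (1 + \<alpha>)) I u"
proof -
  have op: "open \<Omega>"
  proof -
    have "open {x :: real ^ 'n. R\<^sub>1 < norm x \<and> norm x < R\<^sub>2}" for R\<^sub>1 R\<^sub>2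
      by (intro open_Collect_conj open_Collect_less continuous_intros)
    then show ?thesis using domain unfolding ball_or_annulus_def by auto
  qed
  have in_\<Omega>: "x \<in> \<Omega> \<longleftrightarrow> norm x \<in> I" for x
    using domain unfolding ball_or_annulus_def by auto
  have zero: "F x p 0 = 0" if "x \<in> \<Omega>" "p \<noteq> 0" for x p
    using F_homogeneous[OF that zero_sym, of 1 2] by simp
  have sup_v: "viscosity_supersolution \<Omega> F f v"
    and sub_v: "viscosity_supersolution \<Omega> (\<lambda>x p M. - F x (- p) (- M)) (\<lambda>r. - f r) (\<lambda>x. - v x)"
    using solution subsolution_uminus unfolding viscosity_solution_def by blast+
  have cont: "continuous_on \<Omega> v" "continuous_on \<Omega> (\<lambda>x. - v x)"
    using sup_v sub_v unfolding viscosity_supersolution_def by blast+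
  have neg_sym: "- M \<in> sym_matrices" if "M \<in> sym_matrices" for M :: "real ^ 'n ^ 'n"
    using that by (simp add: sym_matrices_def transpose_def vec_eq_iff)
  have add_sym: "M + Q \<in> sym_matrices" if "M \<in> sym_matrices" "Q \<in> psd_matrices" for M Q :: "real ^ 'n ^ 'n"
    using that by (simp add: sym_matrices_def psd_matrices_def transpose_add)
  interpret elliptic_radial_solution \<Omega> F \<alpha> a A f v I u
  proof (unfold_locales)
    fix x p :: "real ^ 'n" and M Q :: "real ^ 'n ^ 'n"
    assume x: "x \<in> \<Omega>" "p \<noteq> 0" and M: "M \<in> sym_matrices" and Q: "Q \<in> psd_matrices"
    show "a * norm p powr \<alpha> * trace Q \<le> - F x (- p) (- (M + Q)) - - F x (- p) (- M) \<and>
      - F x (- p) (- (M + Q)) - - F x (- p) (- M) \<le> A * norm p powr \<alpha> * trace Q"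
      using F_elliptic[OF x(1), of "- p" "- (M + Q)" Q] x neg_sym[OF add_sym[OF M Q]] Q
      by simp
  qed (use op alpha_a_A zero F_elliptic cont in_\<Omega> radial f_cont supersolution_tested[OF op sup_v]
        supersolution_tested[OF op sub_v] in auto)
  show ?thesis
    using domain C1_holder_ball C1_holder_annulus unfolding ball_or_annulus_def by blast
qed

end
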